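(* The simplex $\widetilde D$ has a unique integral vertex (that is, a unique vertex lying in the coroot lattice $Q^\vee$), and this vertex corresponds to the unique maximal $\mathsf{ad}$-nilpotent ideal $\Delta^+$, i.e. it is the point $d_{\Delta^+}$.
   Context: Let $\Delta$ be the (reduced, irreducible, crystallographic) root system of a simple Lie algebra $\mathfrak g$ of rank $p$, with Weyl group $W$, positive roots $\Delta^+$, simple roots $\Pi=\{\alpha_1,\dots,\alpha_p\}$ and highest root $\theta$. Let $V=\bigoplus_{i=1}^p\mathbb Q\alpha_i$ with a $W$-invariant inner product $(\ ,\ )$; $\mu^\vee=2\mu/(\mu,\mu)$, and $Q^\vee=\bigoplus_i\mathbb Z\alpha_i^\vee\subset V$ is the coroot lattice. The simplex is $\widetilde D=\{\tau\in V\mid(\tau,\alpha)\ge-1\ \ \forall\alpha\in\Pi,\ (\tau,\theta)\le2\}$. An $\mathsf{ad}$-nilpotent ideal is a subset $I\subset\Delta^+$ such that $\gamma\in I$, $\nu\in\Delta^+$, $\gamma+\nu\in\Delta$ imply $\gamma+\nu\in I$. The correspondence $I\mapsto d_I$: let $\widehat V=V\oplus\mathbb Q\delta\oplus\mathbb Q\lambda$, with $(\ ,\ )$ extended by $(\delta,V)=(\lambda,V)=(\delta,\delta)=(\lambda,\lambda)=0$, $(\delta,\lambda)=1$. Affine real roots: $\widehat\Delta=\{\beta+k\delta\mid\beta\in\Delta,\ k\in\mathbb Z\}$; $\widehat\Delta^+=\Delta^+\cup\{\beta+k\delta\mid\beta\in\Delta,\ k\ge1\}$; simple roots $\widehat\Pi=\Pi\cup\{\alpha_0\}$,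 $\alpha_0=\delta-\theta$. The affine Weyl group $\widehat W$ is generated by the reflections of $\widehat V$ in $\alpha_0,\dots,\alpha_p$. An element $w\in\widehat W$ is admissible if (a) $w(\alpha)\in\widehat\Delta^+$ for all $\alpha\in\Pi$, and (b) whenever $\alpha\in\widehat\Pi$ and $w^{-1}(\alpha)\in-\widehat\Delta^+$, one has $w^{-1}(\alpha)=\gamma-\delta$ for some $\gamma\in\Delta^+$. By Cellini–Papi, $w\mapsto I_w=\{\gamma\in\Delta^+\mid w(\delta-\gamma)\in-\widehat\Delta^+\}$ is a bijection from admissible elements onto $\mathsf{ad}$-nilpotent ideals. Each $w\in\widehat W$ is uniquely $w=v_w\cdot t_{r_w}$ with $v_w\in W$, $r_w\in Q^\vee$, where $t_r$ acts on $V\oplus\mathbb Q\delta$ by $t_r(x)=x-(x,r)\delta$. If $I=I_w$ with $w$ admissible, put $d_I=v_w(r_w)$. By Cellini–Papi, $I\mapsto d_I$ is a bijection from the set of $\mathsf{ad}$-nilpotent ideals onto $\widetilde D\cap Q^\vee$. *)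

theory Defs
  imports Complex_Main "HOL-Library.Product_Plus"
begin

(* The group generated by a set S of involutions (here: reflections), so that no
   inverses need to be added explicitly. *)
inductive_set refl_group :: "('b \<Rightarrow> 'b) set \<Rightarrow> ('b \<Rightarrow> 'b) set" for S :: "('b \<Rightarrow> 'b) set"
where
  one: "id \<in> refl_group S"
| step: "s \<in> S \<Longrightarrow> w \<in> refl_group S \<Longrightarrow> s \<circ> w \<in> refl_group S"

(* A reduced irreducible crystallographic root system \<Delta> with simple roots \<Pi> and highest
   root \<theta>.  The rational vector space V is the whole type 'v, with basis \<Pi>; the form ip
   is W-invariant because the Weyl group is generated by the ip-orthogonal reflections. *)
locale simple_root_system =
  finite_dimensional_vector_space scale \<Pi>
  for scale :: "rat \<Rightarrow> 'v::ab_group_add \<Rightarrow> 'v" (infixr \<open>*s\<close> 75)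
    and \<Pi> :: "'v set" +
  fixes ip :: "'v \<Rightarrow> 'v \<Rightarrow> rat"
    and \<Delta> :: "'v set"
    and \<theta> :: 'v
  assumes ip_add: "ip (x + y) z = ip x z + ip y z"
    and ip_scale: "ip (a *s x) z = a * ip x z"
    and ip_sym: "ip x y = ip y x"
    and ip_pos: "x \<noteq> 0 \<Longrightarrow> ip x x > 0"
    and roots_finite: "finite \<Delta>"
    and roots_nonempty: "\<Delta> \<noteq> {}"
    and roots_nonzero: "0 \<notin> \<Delta>"
    and roots_reflect: "\<alpha> \<in> \<Delta> \<Longrightarrow> \<beta> \<in> \<Delta> \<Longrightarrow> \<beta> - (2 * ip \<beta> \<alpha> / ip \<alpha> \<alpha>) *s \<alpha> \<in> \<Delta>"
    and roots_crystallographic: "\<alpha> \<in> \<Delta> \<Longrightarrow> \<beta> \<in> \<Delta> \<Longrightarrow> 2 * ip \<beta> \<alpha> / ip \<alpha> \<alpha> \<in> \<int>"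
    and roots_reduced: "\<alpha> \<in> \<Delta> \<Longrightarrow> c *s \<alpha> \<in> \<Delta> \<Longrightarrow> c = 1 \<or> c = - 1"
    and roots_irreducible: "\<Delta> = A \<union> B \<Longrightarrow> A \<inter> B = {} \<Longrightarrow>
          (\<And>x y. x \<in> A \<Longrightarrow> y \<in> B \<Longrightarrow> ip x y = 0) \<Longrightarrow> A = {} \<or> B = {}"
    and simple_roots: "\<Pi> \<subseteq> \<Delta>"
    and roots_pos_or_neg: "\<beta> \<in> \<Delta> \<Longrightarrow> \<exists>c :: 'v \<Rightarrow> nat.
          \<beta> = (\<Sum>\<alpha>\<in>\<Pi>. of_nat (c \<alpha>) *s \<alpha>) \<or> \<beta> = - (\<Sum>\<alpha>\<in>\<Pi>. of_nat (c \<alpha>) *s \<alpha>)"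
    and highest_root: "\<theta> \<in> \<Delta>"
          "\<beta> \<in> \<Delta> \<Longrightarrow> \<exists>c :: 'v \<Rightarrow> nat. \<theta> - \<beta> = (\<Sum>\<alpha>\<in>\<Pi>. of_nat (c \<alpha>) *s \<alpha>)"
begin

definition pos_roots :: "'v set" where
  "pos_roots = {\<beta> \<in> \<Delta>. \<exists>c :: 'v \<Rightarrow> nat. \<beta> = (\<Sum>\<alpha>\<in>\<Pi>. of_nat (c \<alpha>) *s \<alpha>)}"

definition coroot :: "'v \<Rightarrow> 'v" where
  "coroot \<mu> = (2 / ip \<mu> \<mu>) *s \<mu>"

definition coroot_lattice :: "'v set" where
  "coroot_lattice = {x. \<exists>n :: 'v \<Rightarrow> int. x = (\<Sum>\<alpha>\<in>\<Pi>. of_int (n \<alpha>) *s coroot \<alpha>)}"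

definition reflection :: "'v \<Rightarrow> 'v \<Rightarrow> 'v" where
  "reflection \<alpha> x = x - (2 * ip x \<alpha> / ip \<alpha> \<alpha>) *s \<alpha>"

definition weyl :: "('v \<Rightarrow> 'v) set" where
  "weyl = refl_group (reflection ` \<Delta>)"

definition ad_nilpotent :: "'v set \<Rightarrow> bool" where
  "ad_nilpotent I \<longleftrightarrow> I \<subseteq> pos_roots \<and>
     (\<forall>\<gamma>\<in>I. \<forall>\<nu>\<in>pos_roots. \<gamma> + \<nu> \<in> \<Delta> \<longrightarrow> \<gamma> + \<nu> \<in> I)"

definition maximal_ad_nilpotent :: "'v set \<Rightarrow> bool" where
  "maximal_ad_nilpotent I \<longleftrightarrow> ad_nilpotent I \<and> (\<forall>J. ad_nilpotent J \<and> I \<subseteq> J \<longrightarrow> J = I)"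

definition simplex_D :: "'v set" where
  "simplex_D = {\<tau>. (\<forall>\<alpha>\<in>\<Pi>. ip \<tau> \<alpha> \<ge> - 1) \<and> ip \<tau> \<theta> \<le> 2}"

(* Extreme points over the rationals; the library notion extreme_point_of is for real spaces only. *)
definition vertex :: "'v \<Rightarrow> 'v set \<Rightarrow> bool" where
  "vertex x S \<longleftrightarrow> x \<in> S \<and>
     (\<forall>a\<in>S. \<forall>b\<in>S. \<forall>u. a \<noteq> b \<and> 0 < u \<and> u < 1 \<longrightarrow> x \<noteq> (1 - u) *s a + u *s b)"

(* The triple (x, a, b) stands for x + a \<delta> + b \<lambda>. *)
definition delta :: "'v \<times> rat \<times> rat" where
  "delta = (0, 1, 0)"

definition emb :: "'v \<Rightarrow> 'v \<times> rat \<times> rat" where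
  "emb x = (x, 0, 0)"

fun ascale :: "rat \<Rightarrow> 'v \<times> rat \<times> rat \<Rightarrow> 'v \<times> rat \<times> rat" where
  "ascale c (x, a, b) = (c *s x, c * a, c * b)"

fun aip :: "'v \<times> rat \<times> rat \<Rightarrow> 'v \<times> rat \<times> rat \<Rightarrow> rat" where
  "aip (x, a, b) (y, c, d) = ip x y + a * d + b * c"

definition apos_roots :: "('v \<times> rat \<times> rat) set" where
  "apos_roots = emb ` pos_roots \<union>
     {emb \<beta> + ascale (of_int k) delta | \<beta> k. \<beta> \<in> \<Delta> \<and> k \<ge> 1}"

definition asimple_roots :: "('v \<times> rat \<times> rat) set" where
  "asimple_roots = insert (delta - emb \<theta>) (emb ` \<Pi>)"

definition areflection :: "'v \<times> rat \<times> rat \<Rightarrow> 'v \<times> rat \<times> rat \<Rightarrow> 'v \<times> rat \<times> rat" where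
  "areflection \<alpha> x = x - ascale (2 * aip x \<alpha> / aip \<alpha> \<alpha>) \<alpha>"

definition affine_weyl :: "('v \<times> rat \<times> rat \<Rightarrow> 'v \<times> rat \<times> rat) set" where
  "affine_weyl = refl_group (areflection ` asimple_roots)"

definition admissible :: "('v \<times> rat \<times> rat \<Rightarrow> 'v \<times> rat \<times> rat) \<Rightarrow> bool" where
  "admissible w \<longleftrightarrow> w \<in> affine_weyl \<and>
     (\<forall>\<alpha>\<in>\<Pi>. w (emb \<alpha>) \<in> apos_roots) \<and>
     (\<forall>\<alpha>\<in>asimple_roots. inv w \<alpha> \<in> uminus ` apos_roots \<longrightarrow>
        (\<exists>\<gamma>\<in>pos_roots. inv w \<alpha> = emb \<gamma> - delta))"

definition ideal_of :: "('v \<times> rat \<times> rat \<Rightarrow> 'v \<times> rat \<times> rat) \<Rightarrow> 'v set" where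
  "ideal_of w = {\<gamma> \<in> pos_roots. w (delta - emb \<gamma>) \<in> uminus ` apos_roots}"

fun lift :: "('v \<Rightarrow> 'v) \<Rightarrow> 'v \<times> rat \<times> rat \<Rightarrow> 'v \<times> rat \<times> rat" where
  "lift v (x, a, b) = (v x, a, b)"

(* The translation t_r as an isometry of the whole affine space: on a general vector z it is
   t_r(z) = z + (z,\<delta>) r - ((z,r) + (r,r)(z,\<delta>)/2) \<delta>, where (z,\<delta>) is the \<lambda>-coordinate b of z. *)
fun translation :: "'v \<Rightarrow> 'v \<times> rat \<times> rat \<Rightarrow> 'v \<times> rat \<times> rat" where
  "translation r (x, a, b) = (x + b *s r, a - (ip x r + ip r r * b / 2), b)"

lemma translation_V_delta:
  "translation r (x, a, 0) = (x, a, 0) - ascale (aip (x, a, 0) (emb r)) delta"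
  by (simp add: delta_def emb_def)

(* The point d_I: take the admissible w with I_w = I, write w = v t_r, and form v(r). *)
definition d_point :: "'v set \<Rightarrow> 'v" where
  "d_point I = (THE d. \<exists>w v r. admissible w \<and> ideal_of w = I \<and>
     v \<in> weyl \<and> r \<in> coroot_lattice \<and> w = lift v \<circ> translation r \<and> d = v r)"

end

end

theory Submission
  imports Defs
begin

text \<open>
  Write \<open>\<rho>\<close> for the vector pairing to 1 with every simple root, \<open>h\<close> for the Coxeter number and
  \<open>c = \<rho> / h\<close> for the centre of the fundamental alcove, which the affine Weyl group moves freely.
  The simplex is the alcove dilated from \<open>c\<close> by the factor \<open>h + 1\<close>, so at a vertex \<open>\<tau>\<close>
  all but one of the affine simple roots take the value \<open>-1\<close>.

  Uniqueness: for an integral vertex \<open>\<tau>\<close> choose \<open>u\<close> in the Weyl group making \<open>u(c - \<tau>)\<close> dominant.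
  The images \<open>\<Gamma>\<close> of the facet normals at \<open>\<tau>\<close> are then positive roots that span the space and on which
  \<open>u(c - \<tau>)\<close> takes the constant value \<open>1 + 1/h\<close>; let \<open>q\<close> be the multiple with value 1.
  Reflections in \<open>\<Gamma>\<close> carry \<open>- q\<close> to \<open>q\<close>, so \<open>2q\<close> pairs integrally with all roots and simple
  roots have \<open>q\<close>-value 1 or 1/2.  A root of \<open>q\<close>-value 1 is a simple root of value 1 or a sum of two
  adjacent simple roots of value 1/2; as the Dynkin diagram is a forest, a 2-colouring of the latter
  yields a functional vanishing on \<open>\<Gamma>\<close>, which is impossible unless no value 1/2 occurs.  Hence
  \<open>u(c - \<tau>) = \<rho> + c\<close> whatever \<open>\<tau>\<close> is, and freeness at \<open>c\<close> determines \<open>\<tau>\<close>.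

  Existence: \<open>\<rho> + c\<close> lies in the orbit of \<open>c\<close>, and the affine Weyl group element carrying it to
  \<open>c\<close> is admissible with ideal \<open>\<Delta>\<^sup>+\<close>.  Conversely, if \<open>w = v t\<^sub>r\<close> is admissible with this ideal, then
  \<open>w(\<alpha>) - \<delta>\<close> is an affine simple root for every simple \<open>\<alpha>\<close>, and these equations say that
  \<open>v(r)\<close> is a vertex.
\<close>

section \<open>Groups generated by involutions\<close>

lemma refl_group_generator: "s \<in> S \<Longrightarrow> s \<in> refl_group S"
  using refl_group.step[OF _ refl_group.one, of s S] by simp

lemma refl_group_comp: "u \<in> refl_group S \<Longrightarrow> w \<in> refl_group S \<Longrightarrow> u \<circ> w \<in> refl_group S"
  by (induction u rule: refl_group.induct) (auto simp: comp_assoc intro: refl_group.step)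

lemma refl_group_inverse:
  assumes "w \<in> refl_group S" and inv: "\<And>s x. s \<in> S \<Longrightarrow> s (s x) = x"
  shows "\<exists>u\<in>refl_group S. (\<forall>x. u (w x) = x) \<and> (\<forall>x. w (u x) = x)"
  using assms(1)
proof (induction w rule: refl_group.induct)
  case one
  then show ?case using refl_group.one by (intro bexI[of _ id]) auto
next
  case (step s w)
  then obtain u where u: "u \<in> refl_group S" "\<forall>x. u (w x) = x" "\<forall>x. w (u x) = x" by blast
  have "u \<circ> s \<in> refl_group S" using u(1) step.hyps(1) refl_group_comp refl_group_generator by metis
  then show ?case using u inv[OF step.hyps(1)] by (intro bexI[of _ "u \<circ> s"]) auto
qed

context simple_root_system
begin

subsection \<open>Root system basics\<close>

lemma ip_zero [simp]: "ip 0 z = 0" "ip z 0 = 0"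
proof -
  show "ip 0 z = 0" using ip_scale[of 0 0 z] by simp
  then show "ip z 0 = 0" by (simp add: ip_sym)
qed

lemma ip_add_right: "ip z (x + y) = ip z x + ip z y"
  by (metis ip_add ip_sym)

lemma ip_scale_right: "ip z (a *s x) = a * ip z x"
  by (metis ip_scale ip_sym)

lemma ip_minus [simp]: "ip (- x) z = - ip x z" "ip z (- x) = - ip z x"
  using ip_scale[of "-1" x z] ip_scale_right[of z "-1" x] by simp_all

lemma ip_diff: "ip (x - y) z = ip x z - ip y z" "ip z (x - y) = ip z x - ip z y"
  using ip_add[of x "- y" z] ip_add_right[of z x "- y"] by simp_all

lemma ip_sum: "ip (\<Sum>i\<in>A. f i) z = (\<Sum>i\<in>A. ip (f i) z)"
  by (induction A rule: infinite_finite_induct) (simp_all add: ip_add)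

lemma ip_sum_right: "ip z (\<Sum>i\<in>A. f i) = (\<Sum>i\<in>A. ip z (f i))"
  by (induction A rule: infinite_finite_induct) (simp_all add: ip_add_right)

lemmas ip_linear = ip_add ip_add_right ip_diff ip_scale ip_scale_right

lemma ip_self_eq_0_iff [simp]: "ip x x = 0 \<longleftrightarrow> x = 0"
  using ip_pos[of x] by fastforce

lemma ip_self_nonneg: "ip x x \<ge> 0"
  using ip_pos[of x] by (cases "x = 0") auto

lemma ip_root_pos: "\<alpha> \<in> \<Delta> \<Longrightarrow> ip \<alpha> \<alpha> > 0"
  using ip_pos[of \<alpha>] roots_nonzero by blast

section \<open>Coordinates with respect to the simple roots\<close>

definition coord :: "'v \<Rightarrow> 'v \<Rightarrow> rat" where
  "coord \<alpha> v = representation \<Pi> v \<alpha>"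

lemma coord_add [simp]: "coord \<alpha> (v + w) = coord \<alpha> v + coord \<alpha> w"
  unfolding coord_def
  by (subst representation_add) (auto simp: independent_Basis span_Basis)

lemma coord_scale [simp]: "coord \<alpha> (c *s v) = c * coord \<alpha> v"
  unfolding coord_def
  by (subst representation_scale) (auto simp: independent_Basis span_Basis)

lemma coord_zero [simp]: "coord \<alpha> 0 = 0"
  using coord_scale[of \<alpha> 0 0] by simp

lemma coord_minus [simp]: "coord \<alpha> (- v) = - coord \<alpha> v"
  using coord_scale[of \<alpha> "-1" v] by simp

lemma coord_diff [simp]: "coord \<alpha> (v - w) = coord \<alpha> v - coord \<alpha> w"
  using coord_add[of \<alpha> v "- w"] by simp

lemma coord_sum: "coord \<alpha> (\<Sum>i\<in>A. f i) = (\<Sum>i\<in>A. coord \<alpha> (f i))"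
  by (induction A rule: infinite_finite_induct) simp_all

lemma coord_simple: "\<beta> \<in> \<Pi> \<Longrightarrow> coord \<alpha> \<beta> = (if \<alpha> = \<beta> then 1 else 0)"
  unfolding coord_def by (subst representation_basis) (auto simp: independent_Basis)

lemma coord_expand: "v = (\<Sum>\<alpha>\<in>\<Pi>. coord \<alpha> v *s \<alpha>)"
  unfolding coord_def
  by (rule sum_representation_eq[symmetric]) (auto simp: independent_Basis span_Basis finite_Basis)

lemma coord_lincomb: "\<alpha> \<in> \<Pi> \<Longrightarrow> coord \<alpha> (\<Sum>\<beta>\<in>\<Pi>. f \<beta> *s \<beta>) = f \<alpha>"
  by (simp add: coord_sum coord_simple if_distrib sum.delta' finite_Basis cong: if_cong)

lemma coord_eqI: "(\<And>\<alpha>. \<alpha> \<in> \<Pi> \<Longrightarrow> coord \<alpha> v = coord \<alpha> w) \<Longrightarrow> v = w"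
  by (subst coord_expand[of v], subst coord_expand[of w]) simp

lemma ip_expand: "ip z v = (\<Sum>\<alpha>\<in>\<Pi>. coord \<alpha> v * ip z \<alpha>)"
  by (subst coord_expand[of v]) (simp add: ip_sum_right ip_scale_right)

lemma ip_nondegenerate: "(\<And>\<alpha>. \<alpha> \<in> \<Pi> \<Longrightarrow> ip z \<alpha> = 0) \<Longrightarrow> z = 0"
  using ip_expand[of z z] by simp

text \<open>The map \<open>\<phi>\<close> collecting the pairings with the simple roots is injective
  by \<open>ip_nondegenerate\<close>, hence surjective in finite dimension.\<close>

lemma ip_dual_exists: "\<exists>z. \<forall>\<alpha>\<in>\<Pi>. ip z \<alpha> = f \<alpha>"
proof -
  define \<phi> where "\<phi> z = (\<Sum>\<alpha>\<in>\<Pi>. ip z \<alpha> *s \<alpha>)" for z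
  have lin: "Vector_Spaces.linear scale scale \<phi>"
    by unfold_locales
       (simp_all add: \<phi>_def ip_linear scale_left_distrib sum.distrib scale_sum_right)
  interpret \<phi>: Vector_Spaces.linear scale scale \<phi> by (rule lin)
  have co: "coord \<alpha> (\<phi> z) = ip z \<alpha>" if "\<alpha> \<in> \<Pi>" for \<alpha> z
    using coord_lincomb[OF that] by (simp add: \<phi>_def)
  have "inj \<phi>"
  proof (rule injI)
    fix a b assume eq: "\<phi> a = \<phi> b"
    have "ip (a - b) \<alpha> = 0" if "\<alpha> \<in> \<Pi>" for \<alpha>
      using co[OF that, of a] co[OF that, of b] eq by (simp add: ip_linear)
    then have "a - b = 0" by (rule ip_nondegenerate)
    then show "a = b" by simp
  qed
  then have "surj \<phi>" using lin by (intro linear_inj_imp_surj)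
  then obtain z where "\<phi> z = (\<Sum>\<alpha>\<in>\<Pi>. f \<alpha> *s \<alpha>)" by (metis surjD)
  then have "\<forall>\<alpha>\<in>\<Pi>. ip z \<alpha> = f \<alpha>" using co coord_lincomb by metis
  then show ?thesis ..
qed

section \<open>Reflections and coroots\<close>

lemma reflection_coroot: "reflection \<alpha> x = x - ip x \<alpha> *s coroot \<alpha>"
  by (simp add: reflection_def coroot_def mult.commute)

lemma ip_coroot: "ip x (coroot \<alpha>) = 2 * ip x \<alpha> / ip \<alpha> \<alpha>"
  by (simp add: coroot_def ip_scale_right)

lemma reflection_coroot': "reflection \<alpha> x = x - ip x (coroot \<alpha>) *s \<alpha>"
  by (simp add: reflection_def ip_coroot)

lemma ip_coroot_int: "\<alpha> \<in> \<Delta> \<Longrightarrow> \<beta> \<in> \<Delta> \<Longrightarrow> ip \<beta> (coroot \<alpha>) \<in> \<int>"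
  using roots_crystallographic by (simp add: ip_coroot)

lemma root_reflection: "\<alpha> \<in> \<Delta> \<Longrightarrow> \<beta> \<in> \<Delta> \<Longrightarrow> reflection \<alpha> \<beta> \<in> \<Delta>"
  using roots_reflect by (simp add: reflection_def)

lemma reflection_self: "\<alpha> \<noteq> 0 \<Longrightarrow> reflection \<alpha> \<alpha> = - \<alpha>"
  using scale_left_distrib[of 1 1 \<alpha>] by (simp add: reflection_def)

lemma root_minus: "\<alpha> \<in> \<Delta> \<Longrightarrow> - \<alpha> \<in> \<Delta>"
  using root_reflection[of \<alpha> \<alpha>] reflection_self[of \<alpha>] roots_nonzero by fastforce

lemma ip_reflection:
  assumes "\<alpha> \<in> \<Delta>" shows "ip (reflection \<alpha> x) (reflection \<alpha> y) = ip x y"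
  using ip_root_pos[OF assms]
  by (simp add: reflection_def ip_linear ip_sym[of \<alpha> x] ip_sym[of \<alpha> y] field_simps)

lemma ip_reflection_left:
  "ip (reflection \<alpha> x) y = ip x (reflection \<alpha> y)"
  by (simp add: reflection_def ip_linear ip_sym[of \<alpha> y])

lemma reflection_reflection:
  assumes "\<alpha> \<in> \<Delta>" shows "reflection \<alpha> (reflection \<alpha> x) = x"
proof -
  have "ip (reflection \<alpha> x) \<alpha> = - ip x \<alpha>"
    using ip_root_pos[OF assms] by (simp add: reflection_def ip_linear)
  then show ?thesis by (simp add: reflection_def[of _ "reflection \<alpha> x"]) (simp add: reflection_def)
qed

section \<open>Positive roots and their coordinates\<close>

lemma pos_roots_iff: "\<beta> \<in> pos_roots \<longleftrightarrow> \<beta> \<in> \<Delta> \<and> (\<forall>\<alpha>\<in>\<Pi>. coord \<alpha> \<beta> \<ge> 0)"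
proof
  assume "\<beta> \<in> pos_roots"
  then obtain c :: "'v \<Rightarrow> nat" where "\<beta> \<in> \<Delta>" "\<beta> = (\<Sum>\<alpha>\<in>\<Pi>. of_nat (c \<alpha>) *s \<alpha>)"
    by (auto simp: pos_roots_def)
  then show "\<beta> \<in> \<Delta> \<and> (\<forall>\<alpha>\<in>\<Pi>. coord \<alpha> \<beta> \<ge> 0)" by (simp add: coord_lincomb)
next
  assume as: "\<beta> \<in> \<Delta> \<and> (\<forall>\<alpha>\<in>\<Pi>. coord \<alpha> \<beta> \<ge> 0)"
  then obtain c :: "'v \<Rightarrow> nat" where
    "\<beta> = (\<Sum>\<alpha>\<in>\<Pi>. of_nat (c \<alpha>) *s \<alpha>) \<or> \<beta> = - (\<Sum>\<alpha>\<in>\<Pi>. of_nat (c \<alpha>) *s \<alpha>)"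
    using roots_pos_or_neg by blast
  then show "\<beta> \<in> pos_roots"
  proof
    assume neg: "\<beta> = - (\<Sum>\<alpha>\<in>\<Pi>. of_nat (c \<alpha>) *s \<alpha>)"
    then have "coord \<alpha> \<beta> = 0" if "\<alpha> \<in> \<Pi>" for \<alpha>
      using as that by (force simp: coord_lincomb)
    then have "\<beta> = 0" by (intro coord_eqI) simp
    then show ?thesis using as roots_nonzero by blast
  qed (use as in \<open>auto simp: pos_roots_def\<close>)
qed

lemma pos_root: "\<beta> \<in> pos_roots \<Longrightarrow> \<beta> \<in> \<Delta>"
  by (simp add: pos_roots_iff)

lemma simple_root: "\<alpha> \<in> \<Pi> \<Longrightarrow> \<alpha> \<in> \<Delta>"
  using simple_roots by blast

lemma simple_pos_root: "\<alpha> \<in> \<Pi> \<Longrightarrow> \<alpha> \<in> pos_roots"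
  by (simp add: pos_roots_iff simple_root coord_simple)

lemma root_pos_or_neg: "\<beta> \<in> \<Delta> \<Longrightarrow> \<beta> \<in> pos_roots \<or> - \<beta> \<in> pos_roots"
  using roots_pos_or_neg[of \<beta>] root_minus[of \<beta>] unfolding pos_roots_def by force

lemma coord_root_int: "\<beta> \<in> \<Delta> \<Longrightarrow> \<alpha> \<in> \<Pi> \<Longrightarrow> coord \<alpha> \<beta> \<in> \<int>"
  using roots_pos_or_neg[of \<beta>] by (auto simp: coord_lincomb)

text \<open>All coordinates of a root share a sign. This is how reflected or shortened roots are
  recognised as positive.\<close>

lemma pos_root_if_coord_pos:
  assumes "\<beta> \<in> \<Delta>" "\<alpha> \<in> \<Pi>" "coord \<alpha> \<beta> > 0" shows "\<beta> \<in> pos_roots"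
  using root_pos_or_neg[OF assms(1)] assms by (force simp: pos_roots_iff)

lemma pos_root_coord_pos:
  assumes "\<beta> \<in> pos_roots" shows "\<exists>\<alpha>\<in>\<Pi>. coord \<alpha> \<beta> > 0"
proof (rule ccontr)
  assume "\<not> ?thesis"
  then have "\<beta> = 0" using assms by (intro coord_eqI) (force simp: pos_roots_iff)
  then show False using assms roots_nonzero pos_root by blast
qed

lemma not_pos_and_neg: "\<beta> \<in> pos_roots \<Longrightarrow> - \<beta> \<notin> pos_roots"
  using pos_root_coord_pos[of \<beta>] by (force simp: pos_roots_iff)

lemma pos_root_add:
  "\<beta> \<in> pos_roots \<Longrightarrow> \<gamma> \<in> pos_roots \<Longrightarrow> \<beta> + \<gamma> \<in> \<Delta> \<Longrightarrow> \<beta> + \<gamma> \<in> pos_roots"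
  by (simp add: pos_roots_iff)

lemma multiple_of_simple_root:
  assumes "\<beta> \<in> pos_roots" "\<alpha> \<in> \<Pi>" "\<And>\<alpha>'. \<alpha>' \<in> \<Pi> \<Longrightarrow> \<alpha>' \<noteq> \<alpha> \<Longrightarrow> coord \<alpha>' \<beta> = 0"
  shows "\<beta> = \<alpha>"
proof -
  have eq: "\<beta> = coord \<alpha> \<beta> *s \<alpha>"
    using assms by (intro coord_eqI) (auto simp: coord_simple)
  then have "coord \<alpha> \<beta> = 1 \<or> coord \<alpha> \<beta> = - 1"
    using roots_reduced simple_root assms pos_root by metis
  then have "coord \<alpha> \<beta> = 1" using assms by (force simp: pos_roots_iff)
  then show ?thesis using eq by (metis scale_one)
qed

text \<open>Supplies a positive coordinate that subtracting a multiple of \<open>\<alpha>\<close>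
  leaves untouched.\<close>

lemma pos_root_not_simple:
  assumes "\<beta> \<in> pos_roots" "\<alpha> \<in> \<Pi>" "\<beta> \<noteq> \<alpha>"
  obtains \<alpha>' where "\<alpha>' \<in> \<Pi>" "\<alpha>' \<noteq> \<alpha>" "coord \<alpha>' \<beta> > 0"
  using multiple_of_simple_root[OF assms(1,2)] assms by (force simp: pos_roots_iff)

text \<open>Strict Cauchy-Schwarz bounds the product of the two positive Cartan integers by 3, so
  one of them is 1 and the corresponding reflection yields the difference up to sign.\<close>

lemma root_diff:
  assumes "\<beta> \<in> \<Delta>" "\<gamma> \<in> \<Delta>" "ip \<beta> \<gamma> > 0" "\<beta> \<noteq> \<gamma>" shows "\<beta> - \<gamma> \<in> \<Delta>"
proof -
  let ?m = "ip \<beta> (coroot \<gamma>)" and ?n = "ip \<gamma> (coroot \<beta>)"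
  have b: "ip \<beta> \<beta> > 0" and g: "ip \<gamma> \<gamma> > 0" using assms ip_root_pos by auto
  have pos: "?m > 0" "?n > 0" using b g assms(3) by (simp_all add: ip_coroot ip_sym)
  obtain m n :: int where m: "?m = of_int m" and n: "?n = of_int n"
    using ip_coroot_int assms Ints_cases by metis
  \<comment> \<open>Cauchy-Schwarz is strict because proportional roots with positive pairing
    coincide by reducedness.\<close>
  have "\<beta> - (ip \<beta> \<gamma> / ip \<gamma> \<gamma>) *s \<gamma> \<noteq> 0"
  proof
    assume "\<beta> - (ip \<beta> \<gamma> / ip \<gamma> \<gamma>) *s \<gamma> = 0"
    then have eq: "\<beta> = (ip \<beta> \<gamma> / ip \<gamma> \<gamma>) *s \<gamma>" by simp
    then have "ip \<beta> \<gamma> / ip \<gamma> \<gamma> = 1 \<or> ip \<beta> \<gamma> / ip \<gamma> \<gamma> = -1"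
      using roots_reduced assms by metis
    moreover have "ip \<beta> \<gamma> / ip \<gamma> \<gamma> > 0" using assms g by simp
    ultimately have "ip \<beta> \<gamma> / ip \<gamma> \<gamma> = 1" by linarith
    then show False using eq assms(4) by (metis scale_one)
  qed
  from ip_pos[OF this] have "ip \<beta> \<beta> - ip \<beta> \<gamma> * ip \<beta> \<gamma> / ip \<gamma> \<gamma> > 0"
    using g roots_nonzero assms(2)
    by (simp add: ip_linear ip_sym[of \<gamma> \<beta>] field_simps split: if_splits)
  then have "ip \<beta> \<gamma> * ip \<beta> \<gamma> < ip \<beta> \<beta> * ip \<gamma> \<gamma>" using g by (simp add: field_simps)
  then have "?m * ?n < 4" using b g by (simp add: ip_coroot ip_sym[of \<gamma> \<beta>] field_simps)
  then have "of_int (m * n) < (of_int 4 :: rat)" by (simp add: m n)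
  then have mn: "m * n < 4" unfolding of_int_less_iff .
  have mn0: "m > 0" "n > 0" using pos m n by simp_all
  have "m = 1 \<or> n = 1"
  proof (rule ccontr)
    assume "\<not> ?thesis"
    then have "m \<ge> 2" "n \<ge> 2" using mn0 by auto
    then have "2 * 2 \<le> m * n" by (intro mult_mono) auto
    then show False using mn by simp
  qed
  then show ?thesis
  proof
    assume "m = 1"
    then have "reflection \<gamma> \<beta> = \<beta> - \<gamma>" using m by (simp add: reflection_coroot')
    then show ?thesis using root_reflection assms by metis
  next
    assume "n = 1"
    then have "reflection \<beta> \<gamma> = \<gamma> - \<beta>" using n by (simp add: reflection_coroot')
    then show ?thesis using root_reflection[of \<beta> \<gamma>] assms root_minus[of "\<gamma> - \<beta>"] by simp
  qed
qed

text \<open>Otherwise \<open>\<alpha> - \<beta>\<close> would be a root with coordinates of both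
  signs.\<close>

lemma simple_roots_obtuse:
  assumes "\<alpha> \<in> \<Pi>" "\<beta> \<in> \<Pi>" "\<alpha> \<noteq> \<beta>" shows "ip \<alpha> \<beta> \<le> 0"
proof (rule ccontr)
  assume "\<not> ?thesis"
  then have d: "\<alpha> - \<beta> \<in> \<Delta>" using root_diff assms simple_root by auto
  then show False
    using root_pos_or_neg[OF d] assms by (force simp: pos_roots_iff coord_simple)
qed

text \<open>Expanding \<open>ip \<gamma> \<gamma> > 0\<close> in simple roots exhibits one with
  positive pairing, which can be subtracted by \<open>root_diff\<close>.\<close>

lemma pos_root_decompose:
  assumes "\<gamma> \<in> pos_roots" "\<gamma> \<notin> \<Pi>"
  obtains \<alpha> where "\<alpha> \<in> \<Pi>" "\<gamma> - \<alpha> \<in> pos_roots" "ip \<gamma> \<alpha> > 0"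
proof -
  have "ip \<gamma> \<gamma> > 0" using ip_root_pos pos_root assms by blast
  then have "(\<Sum>\<alpha>\<in>\<Pi>. coord \<alpha> \<gamma> * ip \<gamma> \<alpha>) > 0" by (simp only: ip_expand[of \<gamma> \<gamma>])
  then obtain \<alpha> where \<alpha>: "\<alpha> \<in> \<Pi>" "coord \<alpha> \<gamma> * ip \<gamma> \<alpha> > 0"
    by (meson linorder_not_less sum_nonpos)
  then have ip: "ip \<gamma> \<alpha> > 0" using assms by (force simp: pos_roots_iff zero_less_mult_iff)
  have ne: "\<gamma> \<noteq> \<alpha>" using assms \<alpha> by blast
  then have d: "\<gamma> - \<alpha> \<in> \<Delta>" using root_diff ip \<alpha> assms pos_root simple_root by blast
  obtain \<alpha>' where "\<alpha>' \<in> \<Pi>" "\<alpha>' \<noteq> \<alpha>" "coord \<alpha>' \<gamma> > 0"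
    using pos_root_not_simple[OF assms(1) \<alpha>(1) ne] .
  then have "\<gamma> - \<alpha> \<in> pos_roots"
    using pos_root_if_coord_pos[OF d, of \<alpha>'] \<alpha> by (simp add: coord_simple)
  then show ?thesis using that \<alpha> ip by blast
qed

subsection \<open>Heights, the extended simple system and the vertices of the simplex\<close>

definition height :: "'v \<Rightarrow> rat" where
  "height v = (\<Sum>\<alpha>\<in>\<Pi>. coord \<alpha> v)"

definition coxeter_number :: rat where
  "coxeter_number = height \<theta> + 1"

abbreviation "h \<equiv> coxeter_number"

text \<open>Well defined by \<open>ip_dual_exists\<close> and \<open>ip_nondegenerate\<close>; this
  is half the sum of the positive coroots.\<close>

definition rho :: 'v where
  "rho = (SOME z. \<forall>\<alpha>\<in>\<Pi>. ip z \<alpha> = 1)"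

text \<open>All affine simple roots take the common value \<open>1 / h\<close> here
  (\<open>ext_simple_center\<close>), so the point is interior to the fundamental alcove.\<close>

definition center :: 'v where
  "center = (1 / h) *s rho"

lemma height_linear [simp]:
  "height (v + w) = height v + height w" "height (v - w) = height v - height w"
  "height (- v) = - height v" "height (c *s v) = c * height v" "height 0 = 0"
  unfolding height_def by (simp_all add: sum.distrib sum_subtractf sum_negf flip: sum_distrib_left)

lemma height_simple: "\<alpha> \<in> \<Pi> \<Longrightarrow> height \<alpha> = 1"
  by (simp add: height_def coord_simple sum.delta' finite_Basis)

lemma ip_rho: "ip rho v = height v"
proof -
  have "\<forall>\<alpha>\<in>\<Pi>. ip rho \<alpha> = 1"
    unfolding rho_def using ip_dual_exists[of "\<lambda>_. 1"] by (rule someI_ex)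
  then show ?thesis by (simp add: ip_expand[of rho v] height_def)
qed

lemma ip_center: "ip center v = height v / h"
  by (simp add: center_def ip_scale ip_rho)

lemma height_root_int: "\<beta> \<in> \<Delta> \<Longrightarrow> height \<beta> \<in> \<int>"
  unfolding height_def by (intro Ints_sum coord_root_int)

lemma height_nonneg: "(\<And>\<alpha>. \<alpha> \<in> \<Pi> \<Longrightarrow> coord \<alpha> v \<ge> 0) \<Longrightarrow> height v \<ge> 0"
  unfolding height_def by (rule sum_nonneg) auto

lemma height_nonneg_eq_0:
  assumes "\<And>\<alpha>. \<alpha> \<in> \<Pi> \<Longrightarrow> coord \<alpha> v \<ge> 0" "height v = 0" shows "v = 0"
proof -
  have "\<forall>\<alpha>\<in>\<Pi>. coord \<alpha> v = 0"
    using assms sum_nonneg_eq_0_iff[OF finite_Basis, of "\<lambda>\<alpha>. coord \<alpha> v"] by (simp add: height_def)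
  then show ?thesis by (intro coord_eqI) simp
qed

lemma height_pos_root: "\<beta> \<in> pos_roots \<Longrightarrow> height \<beta> \<ge> 1"
proof -
  assume b: "\<beta> \<in> pos_roots"
  then have "height \<beta> \<ge> 0" by (intro height_nonneg) (auto simp: pos_roots_iff)
  moreover have "height \<beta> \<noteq> 0" using height_nonneg_eq_0[of \<beta>] b roots_nonzero
    by (auto simp: pos_roots_iff)
  moreover obtain n :: int where "height \<beta> = of_int n"
    using height_root_int b pos_root Ints_cases by metis
  ultimately show ?thesis by simp
qed

lemma pos_root_iff_height: "\<beta> \<in> \<Delta> \<Longrightarrow> \<beta> \<in> pos_roots \<longleftrightarrow> height \<beta> > 0"
  using height_pos_root[of \<beta>] height_pos_root[of "- \<beta>"] root_pos_or_neg[of \<beta>] by force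

lemma height_root_nonzero: "\<beta> \<in> \<Delta> \<Longrightarrow> height \<beta> \<noteq> 0"
  using height_pos_root[of \<beta>] height_pos_root[of "- \<beta>"] root_pos_or_neg[of \<beta>] by force

lemma coord_le_highest: "\<beta> \<in> \<Delta> \<Longrightarrow> \<alpha> \<in> \<Pi> \<Longrightarrow> coord \<alpha> \<beta> \<le> coord \<alpha> \<theta>"
proof -
  assume b: "\<beta> \<in> \<Delta>" and a: "\<alpha> \<in> \<Pi>"
  obtain c :: "'v \<Rightarrow> nat" where "\<theta> - \<beta> = (\<Sum>\<alpha>\<in>\<Pi>. of_nat (c \<alpha>) *s \<alpha>)"
    using highest_root(2)[OF b] by blast
  then have "coord \<alpha> (\<theta> - \<beta>) \<ge> 0" using a by (simp add: coord_lincomb)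
  then show ?thesis by simp
qed

lemma coord_highest: "\<alpha> \<in> \<Pi> \<Longrightarrow> coord \<alpha> \<theta> \<ge> 1"
  using coord_le_highest[of \<alpha> \<alpha>] by (simp add: coord_simple simple_root)

lemma highest_pos_root: "\<theta> \<in> pos_roots"
  using coord_highest by (force simp: pos_roots_iff highest_root)

lemma minus_highest_not_simple: "- \<theta> \<notin> \<Pi>"
  using not_pos_and_neg[OF highest_pos_root] simple_pos_root by blast

lemma height_le_highest: "\<beta> \<in> \<Delta> \<Longrightarrow> height \<beta> \<le> h - 1"
  unfolding coxeter_number_def height_def using coord_le_highest by (simp add: sum_mono)

lemma height_highest: "height \<theta> = h - 1"
  by (simp add: coxeter_number_def)

lemma height_eq_highest: "\<beta> \<in> \<Delta> \<Longrightarrow> height \<beta> = h - 1 \<Longrightarrow> \<beta> = \<theta>"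
  using height_nonneg_eq_0[of "\<theta> - \<beta>"] coord_le_highest[of \<beta>] by (simp add: height_highest)

lemma height_ge_lowest: "\<beta> \<in> \<Delta> \<Longrightarrow> height \<beta> \<ge> 1 - h"
  using height_le_highest[of "- \<beta>"] root_minus[of \<beta>] by simp

lemma coxeter_number_ge_2: "h \<ge> 2"
  using height_pos_root[OF highest_pos_root] by (simp add: coxeter_number_def)

lemma coxeter_number_int: "h \<in> \<int>"
  unfolding coxeter_number_def by (intro Ints_add height_root_int highest_root Ints_1)

text \<open>The finite parts of the affine simple roots, their \<open>\<delta>\<close>-coefficients, and the
  coefficients of the linear relation between them.\<close>

definition ext_simple :: "'v set" where
  "ext_simple = insert (- \<theta>) \<Pi>"

definition level :: "'v \<Rightarrow> rat" where
  "level e = (if e = - \<theta> then 1 else 0)"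

definition mark :: "'v \<Rightarrow> rat" where
  "mark e = (if e = - \<theta> then 1 else coord e \<theta>)"

lemma finite_ext_simple [simp]: "finite ext_simple"
  by (simp add: ext_simple_def finite_Basis)

lemma ext_simple_root: "e \<in> ext_simple \<Longrightarrow> e \<in> \<Delta>"
  using root_minus[OF highest_root(1)] simple_root by (auto simp: ext_simple_def)

lemma level_int: "level e \<in> \<int>"
  by (simp add: level_def)

lemma mark_ge_1: "e \<in> ext_simple \<Longrightarrow> mark e \<ge> 1"
  using coord_highest by (auto simp: mark_def ext_simple_def)

lemma level_mark_simple:
  "\<alpha> \<in> \<Pi> \<Longrightarrow> level \<alpha> = 0" "\<alpha> \<in> \<Pi> \<Longrightarrow> mark \<alpha> = coord \<alpha> \<theta>"
  using minus_highest_not_simple by (auto simp: level_def mark_def)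

lemma sum_ext_simple: "(\<Sum>e\<in>ext_simple. f e) = f (- \<theta>) + (\<Sum>\<alpha>\<in>\<Pi>. f \<alpha>)"
  unfolding ext_simple_def using minus_highest_not_simple by (simp add: finite_Basis)

lemma sum_mark_level: "(\<Sum>e\<in>ext_simple. mark e * level e) = 1"
  by (simp add: sum_ext_simple level_mark_simple level_def[of "- \<theta>"] mark_def[of "- \<theta>"])

lemma sum_mark: "(\<Sum>e\<in>ext_simple. mark e) = h"
  by (simp add: sum_ext_simple level_mark_simple mark_def[of "- \<theta>"] coxeter_number_def height_def)

lemma sum_mark_ip: "(\<Sum>e\<in>ext_simple. mark e * ip z e) = 0"
  by (simp add: sum_ext_simple level_mark_simple mark_def[of "- \<theta>"] ip_expand[of z \<theta>])

lemma ext_simple_center: "e \<in> ext_simple \<Longrightarrow> ip center e + level e = 1 / h"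
  using coxeter_number_ge_2
  by (auto simp: ext_simple_def level_mark_simple ip_center height_simple level_def[of "- \<theta>"]
        height_highest field_simps)

lemma sum_remove_ext_simple:
  "g \<in> ext_simple \<Longrightarrow> (\<Sum>e\<in>ext_simple. f e) = f g + (\<Sum>e\<in>ext_simple - {g}. f e)"
  by (simp add: sum.remove)

text \<open>The linear relation with nonzero coefficients \<open>mark\<close> recovers the pairing
  with the omitted root \<open>g\<close>.\<close>

lemma ext_simple_nondegenerate:
  assumes "g \<in> ext_simple" "\<And>e. e \<in> ext_simple - {g} \<Longrightarrow> ip z e = 0" shows "z = 0"
proof -
  have "mark g * ip z g = 0"
    using sum_mark_ip[of z] assms by (simp add: sum_remove_ext_simple[OF assms(1)])
  then have "ip z g = 0" using mark_ge_1[OF assms(1)] by simp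
  then show ?thesis using assms(2) by (intro ip_nondegenerate) (auto simp: ext_simple_def)
qed

text \<open>Values on the simple roots can be prescribed freely; the hypothesis says that
  \<open>- \<theta>\<close> then receives the prescribed one.\<close>

lemma ext_simple_dual_exists:
  assumes "(\<Sum>e\<in>ext_simple. mark e * f e) = 0" shows "\<exists>z. \<forall>e\<in>ext_simple. ip z e = f e"
proof -
  obtain z where z: "\<forall>\<alpha>\<in>\<Pi>. ip z \<alpha> = f \<alpha>" using ip_dual_exists by blast
  have "f (- \<theta>) + (\<Sum>\<alpha>\<in>\<Pi>. coord \<alpha> \<theta> * f \<alpha>) = 0"
    using assms by (simp add: sum_ext_simple level_mark_simple mark_def[of "- \<theta>"])
  then have "ip z (- \<theta>) = f (- \<theta>)" using z by (simp add: ip_expand[of z \<theta>])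
  then show ?thesis using z by (auto simp: ext_simple_def)
qed

text \<open>Since \<open>mark g\<close> is nonzero, the linear relation expresses \<open>g\<close>
  through the remaining elements.\<close>

lemma span_ext_simple_remove:
  assumes g: "g \<in> ext_simple" shows "span (ext_simple - {g}) = UNIV"
proof -
  let ?S = "span (ext_simple - {g})"
  have "g \<in> ?S"
  proof -
    have "(\<Sum>e\<in>ext_simple. mark e *s e) = 0"
    proof (rule ip_nondegenerate)
      fix \<alpha>
      show "ip (\<Sum>e\<in>ext_simple. mark e *s e) \<alpha> = 0"
        using sum_mark_ip[of \<alpha>] by (simp add: ip_sum ip_scale ip_sum_right ip_scale_right ip_sym[of _ \<alpha>])
    qed
    then have "mark g *s g = - (\<Sum>e\<in>ext_simple - {g}. mark e *s e)"
      using g by (simp add: sum_remove_ext_simple eq_neg_iff_add_eq_0)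
    then have "mark g *s g \<in> ?S"
      by (simp only:) (intro span_neg span_sum span_scale span_base)
    then have "(1 / mark g) *s (mark g *s g) \<in> ?S" by (rule span_scale)
    then show ?thesis using mark_ge_1[OF g] by simp
  qed
  moreover have "e \<in> ?S" if "e \<in> ext_simple - {g}" for e using that by (rule span_base)
  ultimately have "\<Pi> \<subseteq> ?S" unfolding ext_simple_def by blast
  then have "span \<Pi> \<subseteq> ?S" by (rule span_minimal) (rule subspace_span)
  then show ?thesis using span_Basis by auto
qed

text \<open>Counting \<open>- \<theta>\<close> at level 1 gives the bound by 2 the same shape as the
  bounds by -1: every affine simple root is at least -1 at \<open>\<tau>\<close>.\<close>

lemma simplex_D_iff: "\<tau> \<in> simplex_D \<longleftrightarrow> (\<forall>e\<in>ext_simple. ip \<tau> e + 1 + level e \<ge> 0)"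
  by (auto simp: simplex_D_def ext_simple_def level_mark_simple level_def[of "- \<theta>"] )

text \<open>The marked sum of the affine simple roots is \<delta>, so the facet functions have a
  constant weighted sum. In particular they cannot all vanish at once.\<close>

lemma sum_mark_facets: "(\<Sum>e\<in>ext_simple. mark e * (ip \<tau> e + 1 + level e)) = h + 1"
  by (simp add: distrib_left sum.distrib sum_mark sum_mark_level sum_mark_ip)

text \<open>The one free facet function is forced to be \<open>(h + 1) / mark g\<close>, which puts
  \<open>\<tau>\<close> in the simplex. A proper convex combination of nonnegative values vanishes
  only if both do, so the endpoints agree on the other facets.\<close>

lemma vertex_if_facets:
  assumes g: "g \<in> ext_simple" and eq: "\<And>e. e \<in> ext_simple - {g} \<Longrightarrow> ip \<tau> e + 1 + level e = 0"
  shows "vertex \<tau> simplex_D"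
  unfolding vertex_def
proof (intro conjI ballI allI impI notI)
  have "mark g * (ip \<tau> g + 1 + level g) = h + 1"
    using sum_mark_facets[of \<tau>] eq by (simp add: sum_remove_ext_simple[OF g])
  then have "ip \<tau> g + 1 + level g \<ge> 0"
    using mark_ge_1[OF g] coxeter_number_ge_2 zero_le_mult_iff[of "mark g" "ip \<tau> g + 1 + level g"]
    by linarith
  moreover have "ip \<tau> e + 1 + level e \<ge> 0" if "e \<in> ext_simple - {g}" for e using eq[OF that] by simp
  ultimately show "\<tau> \<in> simplex_D" unfolding simplex_D_iff by blast
next
  fix a b u assume ab: "a \<in> simplex_D" "b \<in> simplex_D" and u: "a \<noteq> b \<and> 0 < u \<and> u < 1"
    and \<tau>: "\<tau> = (1 - u) *s a + u *s b"
  have "ip (a - b) e = 0" if e: "e \<in> ext_simple - {g}" for e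
  proof -
    let ?p = "ip a e + 1 + level e" and ?q = "ip b e + 1 + level e"
    have nn: "?p \<ge> 0" "?q \<ge> 0" using ab e by (auto simp: simplex_D_iff)
    have "(1 - u) * ?p + u * ?q = 0"
      using eq[OF e] unfolding \<tau> by (simp add: ip_linear algebra_simps)
    moreover have "(1 - u) * ?p \<ge> 0" "u * ?q \<ge> 0" using nn u by auto
    ultimately have "(1 - u) * ?p = 0" "u * ?q = 0" by linarith+
    then have "?p = 0" "?q = 0" using u by auto
    then show ?thesis by (simp add: ip_linear)
  qed
  then have "a - b = 0" by (rule ext_simple_nondegenerate[OF g])
  then show False using u by simp
qed

text \<open>If two facet functions were positive, a small move changing only these two would stay in
  the simplex both ways, and the point would be a midpoint.\<close>

lemma vertex_facets:
  assumes "vertex \<tau> simplex_D"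
  obtains g where "g \<in> ext_simple" "\<And>e. e \<in> ext_simple - {g} \<Longrightarrow> ip \<tau> e + 1 + level e = 0"
proof -
  let ?f = "\<lambda>\<tau> e. ip \<tau> e + 1 + level e"
  have D: "\<tau> \<in> simplex_D" using assms by (simp add: vertex_def)
  have "(\<Sum>e\<in>ext_simple. mark e * ?f \<tau> e) \<noteq> 0"
    using sum_mark_facets[of \<tau>] coxeter_number_ge_2 by simp
  then obtain g where g: "g \<in> ext_simple" "?f \<tau> g \<noteq> 0"
    by (metis (no_types, lifting) mult_zero_right sum.neutral)
  have "?f \<tau> e = 0" if e: "e \<in> ext_simple - {g}" for e
  proof (rule ccontr)
    assume ne: "?f \<tau> e \<noteq> 0"
    \<comment> \<open>The facet \<open>e\<close> rises, \<open>g\<close> falls and the others stay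
      fixed, in proportions that make the marked sum vanish as \<open>ext_simple_dual_exists\<close>
      requires.\<close>
    define c where "c = (\<lambda>i. if i = e then 1 / mark e else if i = g then - (1 / mark g) else 0)"
    have "(\<Sum>i\<in>ext_simple. mark i * c i)
        = mark g * c g + (mark e * c e + (\<Sum>i\<in>ext_simple - {g} - {e}. mark i * c i))"
      using g e by (simp add: sum.remove)
    also have "\<dots> = 0"
      using e mark_ge_1[OF g(1)] mark_ge_1[of e] by (auto simp: c_def intro!: sum.neutral)
    finally obtain z where z: "\<forall>i\<in>ext_simple. ip z i = c i"
      using ext_simple_dual_exists by blast
    \<comment> \<open>The smaller of the two slacks is a safe step length, because marks are at
      least 1 and so the entries of \<open>c\<close> are at most 1 in absolute value.\<close>
    define \<epsilon> where "\<epsilon> = min (?f \<tau> e) (?f \<tau> g)"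
    have pos: "?f \<tau> e > 0" "?f \<tau> g > 0" using D g e ne by (auto simp: simplex_D_iff order_less_le)
    then have \<epsilon>: "\<epsilon> > 0" by (simp add: \<epsilon>_def)
    have cb: "\<bar>c i\<bar> \<le> 1" if "i \<in> ext_simple" for i
      using mark_ge_1[OF that] by (auto simp: c_def)
    have in_D: "\<tau> + s *s z \<in> simplex_D" if s: "\<bar>s\<bar> = \<epsilon>" for s
      unfolding simplex_D_iff
    proof
      fix i assume i: "i \<in> ext_simple"
      have *: "?f (\<tau> + s *s z) i = ?f \<tau> i + s * c i" using z i by (simp add: ip_linear)
      show "?f (\<tau> + s *s z) i \<ge> 0"
      proof (cases "i = e \<or> i = g")
        case True
        have "\<bar>s * c i\<bar> \<le> \<epsilon> * 1" unfolding abs_mult s using cb[OF i] \<epsilon> by (intro mult_left_mono) auto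
        moreover have "?f \<tau> i \<ge> \<epsilon>" using True by (auto simp: \<epsilon>_def)
        ultimately show ?thesis unfolding * by linarith
      next
        case False
        then have "c i = 0" by (simp add: c_def)
        then show ?thesis unfolding * using D i by (simp add: simplex_D_iff)
      qed
    qed
    have "ip z e \<noteq> 0" using z e mark_ge_1[of e] by (simp add: c_def)
    then have "z \<noteq> 0" by auto
    then have ne2: "\<tau> + \<epsilon> *s z \<noteq> \<tau> + (- \<epsilon>) *s z"
      using \<epsilon> scale_cancel_right[of \<epsilon> z "- \<epsilon>"] by auto
    have "(1 - 1/2) *s (\<tau> + \<epsilon> *s z) + (1/2) *s (\<tau> + (- \<epsilon>) *s z)
          = (1/2 + 1/2) *s \<tau>"
      by (simp only: scale_right_distrib scale_left_distrib scale_scale) simp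
    then have "\<tau> = (1 - 1/2) *s (\<tau> + \<epsilon> *s z) + (1/2) *s (\<tau> + (- \<epsilon>) *s z)" by simp
    moreover have "(0::rat) < 1/2" "(1/2::rat) < 1" by simp_all
    ultimately show False
      using assms in_D[of \<epsilon>] in_D[of "- \<epsilon>"] \<epsilon> ne2 unfolding vertex_def by (metis abs_minus abs_of_pos)
  qed
  then show ?thesis using that g by blast
qed

subsection \<open>Dominant vectors with constant pairing on a spanning set of roots\<close>

text \<open>Each reflection in a wall separating \<open>z\<close> from \<open>c\<close> brings \<open>z\<close> closer to \<open>c\<close>: writing
  \<open>a(z) = (z, e) + k\<close>, one has \<open>|s z - c|\<^sup>2 = |z - c|\<^sup>2 + 4 a(z) a(c) / |e|\<^sup>2\<close>.\<close>

lemma descent: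
  fixes S :: "('v \<times> rat) set"
  assumes P0: "P z0" and \<epsilon>: "\<epsilon> > 0" and S: "S \<subseteq> \<Delta> \<times> UNIV"
    and step: "\<And>z e k. P z \<Longrightarrow> (e, k) \<in> S \<Longrightarrow> ip z e + k < 0 \<Longrightarrow>
      P (z - (ip z e + k) *s coroot e) \<and> (ip z e + k) * (ip c e + k) \<le> - \<epsilon> * ip e e"
  obtains z where "P z" "\<And>e k. (e, k) \<in> S \<Longrightarrow> ip z e + k \<ge> 0"
proof -
  \<comment> \<open>The number \<open>n\<close> bounds the squared distance to \<open>c\<close> in
    units of \<open>\<epsilon>\<close>; each reflection lowers that distance by at least
    \<open>4 * \<epsilon>\<close>.\<close>
  have "\<exists>z. P z \<and> (\<forall>(e, k)\<in>S. ip z e + k \<ge> 0)"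
    if "P z" "ip (z - c) (z - c) < of_nat n * \<epsilon>" for z n
    using that
  proof (induction n arbitrary: z)
    case 0
    then show ?case using ip_self_nonneg[of "z - c"] by simp
  next
    case (Suc n)
    show ?case
    proof (cases "\<forall>(e, k)\<in>S. ip z e + k \<ge> 0")
      case False
      then obtain e k where ek: "(e, k) \<in> S" "ip z e + k < 0" by force
      define a where "a = ip z e + k"
      define z' where "z' = z - a *s coroot e"
      have pos: "ip e e > 0" using ek S ip_root_pos by blast
      have st: "P z'" "a * (ip c e + k) \<le> - \<epsilon> * ip e e"
        using step[OF Suc.prems(1) ek] by (simp_all add: z'_def a_def)
      have zc: "z' - c = (z - c) - a *s coroot e" by (simp add: z'_def)
      have "ip (z' - c) (z' - c)
          = ip (z - c) (z - c) - 2 * a * ip (z - c) (coroot e) + a * a * ip (coroot e) (coroot e)"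
        unfolding zc by (simp add: ip_linear(1-4) ip_scale ip_scale_right ip_sym[of "coroot e" z]
            ip_sym[of "coroot e" c] ip_diff algebra_simps)
      also have "ip (coroot e) (coroot e) = 4 / ip e e"
        using pos by (simp add: ip_coroot ip_sym[of "coroot e" e])
      also have "ip (z - c) (coroot e) = 2 * (a - (ip c e + k)) / ip e e"
        by (simp add: ip_coroot ip_diff a_def)
      also have "ip (z - c) (z - c) - 2 * a * (2 * (a - (ip c e + k)) / ip e e) + a * a * (4 / ip e e)
          = ip (z - c) (z - c) + 4 * (a * (ip c e + k) / ip e e)"
        by (simp add: algebra_simps add_divide_distrib diff_divide_distrib)
      finally have "ip (z' - c) (z' - c) = ip (z - c) (z - c) + 4 * (a * (ip c e + k) / ip e e)" .
      moreover have "a * (ip c e + k) / ip e e \<le> - \<epsilon>" using st(2) pos by (simp add: field_simps)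
      ultimately have "ip (z' - c) (z' - c) < of_nat n * \<epsilon>"
        using Suc.prems(2) \<epsilon> distrib_right[of 1 "of_nat n" \<epsilon>] unfolding of_nat_Suc by linarith
      then show ?thesis using Suc.IH st(1) by blast
    qed (use Suc.prems in blast)
  qed
  moreover obtain n where "ip (z0 - c) (z0 - c) < of_nat n * \<epsilon>"
    using ex_less_of_nat_mult[OF \<epsilon>] by blast
  ultimately obtain z where "P z" "\<forall>(e, k)\<in>S. ip z e + k \<ge> 0" using P0 by blast
  then show ?thesis using that by fast
qed

text \<open>Bounded root lengths turn a gap in the values into the uniform decrease that
  \<open>descent\<close> needs.\<close>

lemma root_norm_bound: obtains M where "M > 0" "\<And>\<beta>. \<beta> \<in> \<Delta> \<Longrightarrow> ip \<beta> \<beta> \<le> M"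
proof -
  have le: "ip \<beta> \<beta> \<le> (\<Sum>\<gamma>\<in>\<Delta>. ip \<gamma> \<gamma>)" if "\<beta> \<in> \<Delta>" for \<beta>
    using that by (intro member_le_sum) (auto simp: roots_finite ip_self_nonneg)
  then have "(\<Sum>\<gamma>\<in>\<Delta>. ip \<gamma> \<gamma>) > 0" using ip_root_pos[OF highest_root(1)] highest_root(1) by fastforce
  then show ?thesis using that le by blast
qed

text \<open>Split an expansion of \<open>q\<close> over \<open>\<Gamma>\<close> into
  \<open>p - n\<close> by the signs of the coefficients. Obtuseness gives
  \<open>ip p n \<le> 0\<close> and dominance gives \<open>ip q n \<ge> 0\<close>, so
  \<open>n = 0\<close> and \<open>q\<close> is a nonnegative combination.\<close>

lemma obtuse_span_ip_nonneg:
  assumes fin: "finite \<Gamma>" and q: "q \<in> span \<Gamma>"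
    and obt: "\<And>\<gamma> \<gamma>'. \<gamma> \<in> \<Gamma> \<Longrightarrow> \<gamma>' \<in> \<Gamma> \<Longrightarrow> \<gamma> \<noteq> \<gamma>' \<Longrightarrow> ip \<gamma> \<gamma>' \<le> 0"
    and q_nn: "\<And>\<gamma>. \<gamma> \<in> \<Gamma> \<Longrightarrow> ip q \<gamma> \<ge> 0"
    and d_nn: "\<And>\<gamma>. \<gamma> \<in> \<Gamma> \<Longrightarrow> ip d \<gamma> \<ge> 0"
  shows "ip q d \<ge> 0"
proof -
  obtain t where t: "q = (\<Sum>\<gamma>\<in>\<Gamma>. t \<gamma> *s \<gamma>)" using q span_finite[OF fin] by auto
  define p where "p = (\<Sum>\<gamma>\<in>\<Gamma>. max (t \<gamma>) 0 *s \<gamma>)"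
  define n where "n = (\<Sum>\<gamma>\<in>\<Gamma>. max (- t \<gamma>) 0 *s \<gamma>)"
  have qpn: "q = p - n"
    unfolding t p_def n_def
    by (auto simp flip: sum_subtractf scale_left_diff_distrib intro!: sum.cong)
  have "ip p n = (\<Sum>\<gamma>\<in>\<Gamma>. \<Sum>\<gamma>'\<in>\<Gamma>. max (t \<gamma>) 0 * (max (- t \<gamma>') 0 * ip \<gamma> \<gamma>'))"
  proof -
    have "ip p n = (\<Sum>\<gamma>\<in>\<Gamma>. max (t \<gamma>) 0 * ip \<gamma> n)" by (simp add: p_def ip_sum ip_scale)
    then show ?thesis by (simp add: n_def ip_sum_right ip_scale_right sum_distrib_left)
  qed
  also have "\<dots> \<le> 0"
  proof (intro sum_nonpos)
    fix \<gamma> \<gamma>' assume g: "\<gamma> \<in> \<Gamma>" "\<gamma>' \<in> \<Gamma>"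
    show "max (t \<gamma>) 0 * (max (- t \<gamma>') 0 * ip \<gamma> \<gamma>') \<le> 0"
    proof (cases "\<gamma> = \<gamma>'")
      case True
      then show ?thesis by (simp add: max_def)
    next
      case False
      then show ?thesis
        by (intro mult_nonneg_nonpos[OF max.cobounded2] obt g)
    qed
  qed
  finally have "ip p n \<le> 0" .
  moreover have "ip q n \<ge> 0"
    unfolding n_def using q_nn by (auto simp: ip_sum_right ip_scale_right intro!: sum_nonneg)
  ultimately have "ip n n \<le> 0" by (simp add: qpn ip_diff)
  then have "n = 0" using ip_pos[of n] by (cases "n = 0") auto
  then have "ip q d = ip p d" by (simp add: qpn)
  also have "\<dots> \<ge> 0"
    unfolding p_def using d_nn by (auto simp: ip_sym[of _ d] ip_sum_right ip_scale_right intro!: sum_nonneg)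
  finally show ?thesis .
qed

text \<open>Reflecting \<open>- q\<close> back into the chamber of \<open>\<Gamma>\<close> leads to \<open>q\<close>, and each reflection changes
  the pairing with a root by an integer.\<close>

lemma half_integral:
  assumes \<Gamma>: "\<Gamma> \<subseteq> \<Delta>" and sp: "span \<Gamma> = UNIV"
    and reg: "\<And>\<beta>. \<beta> \<in> \<Delta> \<Longrightarrow> ip q \<beta> \<noteq> 0"
    and one: "\<And>\<gamma>. \<gamma> \<in> \<Gamma> \<Longrightarrow> ip q \<gamma> = 1"
    and \<beta>: "\<beta> \<in> \<Delta>"
  shows "2 * ip q \<beta> \<in> \<int>"
proof -
  have fin: "finite \<Gamma>" using \<Gamma> roots_finite finite_subset by blast
  \<comment> \<open>A positive pairing would make \<open>\<gamma> - \<gamma>'\<close> a root on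
    which \<open>q\<close> vanishes.\<close>
  have obt: "ip \<gamma> \<gamma>' \<le> 0" if g: "\<gamma> \<in> \<Gamma>" "\<gamma>' \<in> \<Gamma>" "\<gamma> \<noteq> \<gamma>'" for \<gamma> \<gamma>'
  proof (rule ccontr)
    assume "\<not> ?thesis"
    then have "\<gamma> - \<gamma>' \<in> \<Delta>" using g \<Gamma> by (intro root_diff) auto
    then show False using reg[of "\<gamma> - \<gamma>'"] one g by (simp add: ip_diff)
  qed
  obtain M where M: "M > 0" "\<And>\<beta>. \<beta> \<in> \<Delta> \<Longrightarrow> ip \<beta> \<beta> \<le> M" using root_norm_bound by blast
  \<comment> \<open>Three things survive reflection in a root of \<open>\<Gamma>\<close>: the norm
    of \<open>q\<close>, congruence to \<open>- q\<close> modulo integers on all roots, and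
    nonvanishing on roots.\<close>
  define P where "P z \<longleftrightarrow> ip z z = ip q q \<and> (\<forall>\<beta>\<in>\<Delta>. ip z \<beta> + ip q \<beta> \<in> \<int> \<and> ip z \<beta> \<noteq> 0)" for z
  have int: "ip z \<gamma> \<in> \<int>" if "P z" "\<gamma> \<in> \<Gamma>" for z \<gamma>
  proof -
    have "ip z \<gamma> + 1 \<in> \<int>" using that one[of \<gamma>] \<Gamma> unfolding P_def by fastforce
    then have "(ip z \<gamma> + 1) - 1 \<in> \<int>" by (rule Ints_diff) simp
    then show ?thesis by simp
  qed
  obtain z where z: "P z" "\<And>e k. (e, k) \<in> \<Gamma> \<times> {0} \<Longrightarrow> ip z e + k \<ge> 0"
  proof (rule descent[where P = P and ?z0.0 = "- q" and c = q and \<epsilon> = "1 / M" and S = "\<Gamma> \<times> {0}"])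
    show "P (- q)" using reg by (simp add: P_def)
    show "1 / M > 0" using M by simp
    show "\<Gamma> \<times> {0::rat} \<subseteq> \<Delta> \<times> UNIV" using \<Gamma> by blast
    fix z e and k :: rat assume as: "P z" "(e, k) \<in> \<Gamma> \<times> {0}" "ip z e + k < 0"
    then have e: "e \<in> \<Gamma>" "e \<in> \<Delta>" and k: "k = 0" using \<Gamma> by auto
    have eq: "z - (ip z e + k) *s coroot e = reflection e z" by (simp add: k reflection_coroot)
    have "P (reflection e z)"
      unfolding P_def
    proof (intro conjI ballI)
      show "ip (reflection e z) (reflection e z) = ip q q"
        using as(1) e by (simp add: ip_reflection P_def)
      fix \<beta> assume b: "\<beta> \<in> \<Delta>"
      have "ip z e * ip \<beta> (coroot e) \<in> \<int>" using int[OF as(1) e(1)] ip_coroot_int[OF e(2) b] by simp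
      then have "(ip z \<beta> + ip q \<beta>) - ip z e * ip \<beta> (coroot e) \<in> \<int>"
        using as(1) b by (intro Ints_diff) (auto simp: P_def)
      then show "ip (reflection e z) \<beta> + ip q \<beta> \<in> \<int>"
        by (simp add: reflection_coroot ip_diff ip_scale ip_sym[of "coroot e" \<beta>] algebra_simps)
      show "ip (reflection e z) \<beta> \<noteq> 0"
        using as(1) root_reflection[OF e(2) b] by (simp add: ip_reflection_left P_def)
    qed
    moreover have "ip z e \<le> -1" using as(3) k int[OF as(1) e(1)] by (auto elim!: Ints_cases)
    then have "M * ip z e \<le> M * (- 1)" using M(1) by (intro mult_left_mono) auto
    then have "M * ip z e \<le> - ip e e" using M(2)[OF e(2)] by linarith
    ultimately show "P (z - (ip z e + k) *s coroot e) \<and> (ip z e + k) * (ip q e + k) \<le> - (1 / M) * ip e e"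
      using M(1) one[OF e(1)] unfolding eq by (simp add: k field_simps)
  next
    fix z assume "P z" "\<And>e k. (e, k) \<in> \<Gamma> \<times> {0} \<Longrightarrow> ip z e + k \<ge> 0"
    then show thesis using that by blast
  qed
  \<comment> \<open>On \<open>\<Gamma>\<close> the values of \<open>z\<close> are positive integers,
    hence at least the value 1 of \<open>q\<close>.\<close>
  have "ip (z - q) \<gamma> \<ge> 0" if g: "\<gamma> \<in> \<Gamma>" for \<gamma>
  proof -
    have "ip z \<gamma> \<ge> 0" using z(2)[of \<gamma> 0] g by simp
    moreover have "ip z \<gamma> \<noteq> 0" using z(1) g \<Gamma> by (auto simp: P_def)
    ultimately have "ip z \<gamma> \<ge> 1" using int[OF z(1) g] by (auto elim!: Ints_cases)
    then show ?thesis using one[OF g] by (simp add: ip_diff)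
  qed
  then have "ip q (z - q) \<ge> 0"
    using one sp by - (rule obtuse_span_ip_nonneg[OF fin _ obt], auto)
  \<comment> \<open>Both correction terms are nonnegative and the norms agree, so
    \<open>z = q\<close>; congruence to \<open>- q\<close> then becomes integrality of twice
    \<open>q\<close>.\<close>
  moreover have "ip z z = ip q q + 2 * ip q (z - q) + ip (z - q) (z - q)"
    by (simp add: ip_diff ip_sym[of z q])
  moreover have "ip z z = ip q q" using z(1) by (simp add: P_def)
  ultimately have "ip (z - q) (z - q) = 0"
    using ip_self_nonneg[of "z - q"] by linarith
  then have "z = q" by simp
  then show ?thesis using z(1) \<beta> by (simp add: P_def)
qed

text \<open>If every vertex had two neighbours in \<open>S\<close>, the sum over \<open>S\<close> would have nonpositive norm.\<close>

lemma simple_roots_leaf: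
  assumes S: "S \<subseteq> \<Pi>" "S \<noteq> {}"
  obtains \<alpha> where "\<alpha> \<in> S" "\<And>\<beta> \<gamma>. \<beta> \<in> S - {\<alpha>} \<Longrightarrow> \<gamma> \<in> S - {\<alpha>} \<Longrightarrow> ip \<alpha> \<beta> \<noteq> 0 \<Longrightarrow> ip \<alpha> \<gamma> \<noteq> 0 \<Longrightarrow> \<beta> = \<gamma>"
proof (rule ccontr)
  note leaf = that
  assume "\<not> thesis"
  then have two: "\<exists>\<beta>\<in>S - {\<alpha>}. \<exists>\<gamma>\<in>S - {\<alpha>}. ip \<alpha> \<beta> \<noteq> 0 \<and> ip \<alpha> \<gamma> \<noteq> 0 \<and> \<beta> \<noteq> \<gamma>" if "\<alpha> \<in> S" for \<alpha>
    using that leaf[of \<alpha>] by blast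
  have fin: "finite S" using S finite_Basis finite_subset by blast
  define u where "u = \<Sum>S"
  have "ip \<alpha> u \<le> 0" if a: "\<alpha> \<in> S" for \<alpha>
  proof -
    \<comment> \<open>A negative Cartan integer is at most -1, so each neighbour cancels at least
      half of \<open>ip \<alpha> \<alpha>\<close> and two cancel all of it.\<close>
    have half: "2 * ip \<alpha> \<beta> \<le> - ip \<alpha> \<alpha>" if b: "\<beta> \<in> S - {\<alpha>}" "ip \<alpha> \<beta> \<noteq> 0" for \<beta>
    proof -
      have r: "\<alpha> \<in> \<Delta>" "\<beta> \<in> \<Delta>" using a b S simple_root by auto
      have "ip \<alpha> \<beta> < 0" using simple_roots_obtuse[of \<alpha> \<beta>] a b S by force
      then have "ip \<beta> (coroot \<alpha>) < 0"
        using ip_root_pos[OF r(1)] by (simp add: ip_coroot ip_sym[of \<beta>] divide_neg_pos)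
      then have "ip \<beta> (coroot \<alpha>) \<le> -1" using ip_coroot_int[OF r] by (auto elim!: Ints_cases)
      then show ?thesis using ip_root_pos[OF r(1)] by (simp add: ip_coroot ip_sym[of \<beta>] field_simps)
    qed
    obtain \<beta> \<gamma> where bg: "\<beta> \<in> S - {\<alpha>}" "\<gamma> \<in> S - {\<alpha>}" "ip \<alpha> \<beta> \<noteq> 0" "ip \<alpha> \<gamma> \<noteq> 0" "\<beta> \<noteq> \<gamma>"
      using two[OF a] by blast
    have "ip \<alpha> u = ip \<alpha> \<alpha> + (\<Sum>\<delta>\<in>S - {\<alpha>}. ip \<alpha> \<delta>)"
      unfolding u_def ip_sum_right using a fin by (simp add: sum.remove)
    also have "(\<Sum>\<delta>\<in>S - {\<alpha>}. ip \<alpha> \<delta>) \<le> (\<Sum>\<delta>\<in>{\<beta>, \<gamma>}. ip \<alpha> \<delta>)"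
    proof -
      have "(\<Sum>\<delta>\<in>S - {\<alpha>} - {\<beta>, \<gamma>}. ip \<alpha> \<delta>) \<le> 0"
        using a S simple_roots_obtuse by (intro sum_nonpos) blast
      then show ?thesis using fin bg by (subst sum.subset_diff[of "{\<beta>, \<gamma>}"]) auto
    qed
    finally show ?thesis using half[of \<beta>] half[of \<gamma>] bg by simp
  qed
  then have "ip u u \<le> 0" unfolding u_def by (subst ip_sum) (auto intro: sum_nonpos)
  then have "u = 0" using ip_pos[of u] by (cases "u = 0") auto
  obtain \<alpha> where a: "\<alpha> \<in> S" using S by blast
  have "coord \<alpha> u = (\<Sum>\<beta>\<in>S. if \<alpha> = \<beta> then 1 else 0)"
    unfolding u_def coord_sum using S by (intro sum.cong) (auto simp: coord_simple)
  also have "\<dots> = 1" using a fin by simp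
  finally show False using \<open>u = 0\<close> by simp
qed

text \<open>Detach a leaf, colour the rest by induction and give the leaf the negative of its
  neighbour's colour. The colours are nonzero rationals so that they can serve as coefficients of a
  functional.\<close>

lemma simple_roots_two_colouring:
  assumes "S \<subseteq> \<Pi>"
  shows "\<exists>c :: 'v \<Rightarrow> rat. (\<forall>\<alpha>. c \<alpha> \<noteq> 0) \<and>
    (\<forall>\<alpha>\<in>S. \<forall>\<beta>\<in>S. \<alpha> \<noteq> \<beta> \<longrightarrow> ip \<alpha> \<beta> \<noteq> 0 \<longrightarrow> c \<alpha> + c \<beta> = 0)"
proof -
  have "finite S" using assms finite_Basis finite_subset by blast
  then show ?thesis using assms
  proof (induction S rule: finite_psubset_induct)
    case (psubset S)
    show ?case
    proof (cases "S = {}")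
      case False
      obtain \<alpha> where \<alpha>: "\<alpha> \<in> S" and leaf: "\<And>\<beta> \<gamma>. \<beta> \<in> S - {\<alpha>} \<Longrightarrow> \<gamma> \<in> S - {\<alpha>} \<Longrightarrow>
          ip \<alpha> \<beta> \<noteq> 0 \<Longrightarrow> ip \<alpha> \<gamma> \<noteq> 0 \<Longrightarrow> \<beta> = \<gamma>"
        using simple_roots_leaf[OF psubset.prems False] by blast
      have "S - {\<alpha>} \<subset> S" "S - {\<alpha>} \<subseteq> \<Pi>" using \<alpha> psubset.prems by auto
      from psubset.IH[OF this] obtain c :: "'v \<Rightarrow> rat" where c: "\<forall>\<alpha>. c \<alpha> \<noteq> 0"
        "\<forall>\<beta>\<in>S - {\<alpha>}. \<forall>\<gamma>\<in>S - {\<alpha>}. \<beta> \<noteq> \<gamma> \<longrightarrow> ip \<beta> \<gamma> \<noteq> 0 \<longrightarrow> c \<beta> + c \<gamma> = 0"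
        by (elim exE conjE)
      obtain v where v: "v \<noteq> 0" "\<And>\<beta>. \<beta> \<in> S - {\<alpha>} \<Longrightarrow> ip \<alpha> \<beta> \<noteq> 0 \<Longrightarrow> v + c \<beta> = 0"
      proof (cases "\<exists>\<beta>\<in>S - {\<alpha>}. ip \<alpha> \<beta> \<noteq> 0")
        case True
        then obtain \<beta> where \<beta>: "\<beta> \<in> S - {\<alpha>}" "ip \<alpha> \<beta> \<noteq> 0" by blast
        show ?thesis
        proof (rule that[of "- c \<beta>"])
          fix \<gamma> assume "\<gamma> \<in> S - {\<alpha>}" "ip \<alpha> \<gamma> \<noteq> 0"
          then have "\<gamma> = \<beta>" using \<beta> leaf by blast
          then show "- c \<beta> + c \<gamma> = 0" by simp
        qed (simp add: c(1))
      next
        case False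
        then show ?thesis using that[of 1] by auto
      qed
      show ?thesis
      proof (intro exI[of _ "c(\<alpha> := v)"] conjI ballI impI allI)
        fix \<beta> \<gamma> assume bg: "\<beta> \<in> S" "\<gamma> \<in> S" "\<beta> \<noteq> \<gamma>" "ip \<beta> \<gamma> \<noteq> 0"
        show "(c(\<alpha> := v)) \<beta> + (c(\<alpha> := v)) \<gamma> = 0"
          using bg v(2)[of \<beta>] v(2)[of \<gamma>] c(2) ip_sym[of \<beta> \<gamma>] by (auto simp: add.commute)
      qed (use c(1) v(1) in auto)
    qed (auto intro: exI[of _ "\<lambda>_. 1"])
  qed
qed

lemma ip_dominant_nonneg:
  assumes "\<And>\<alpha>. \<alpha> \<in> \<Pi> \<Longrightarrow> ip q \<alpha> > 0" "\<And>\<alpha>. \<alpha> \<in> \<Pi> \<Longrightarrow> coord \<alpha> v \<ge> 0"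
  shows "ip q v \<ge> 0"
  unfolding ip_expand[of q v] using assms by (intro sum_nonneg mult_nonneg_nonneg) (auto intro: less_imp_le)

lemma ip_dominant_eq_0:
  assumes q: "\<And>\<alpha>. \<alpha> \<in> \<Pi> \<Longrightarrow> ip q \<alpha> > 0" and v: "\<And>\<alpha>. \<alpha> \<in> \<Pi> \<Longrightarrow> coord \<alpha> v \<ge> 0" and "ip q v = 0"
  shows "v = 0"
proof -
  have "(\<Sum>\<alpha>\<in>\<Pi>. coord \<alpha> v * ip q \<alpha>) = 0" using assms(3) by (simp only: ip_expand[of q v])
  moreover have "coord \<alpha> v * ip q \<alpha> \<ge> 0" if "\<alpha> \<in> \<Pi>" for \<alpha>
    using q[OF that] v[OF that] by simp
  ultimately have "\<forall>\<alpha>\<in>\<Pi>. coord \<alpha> v * ip q \<alpha> = 0"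
    using sum_nonneg_eq_0_iff[OF finite_Basis, of "\<lambda>\<alpha>. coord \<alpha> v * ip q \<alpha>"] by blast
  then have "coord \<alpha> v = 0" if "\<alpha> \<in> \<Pi>" for \<alpha> using q[OF that] that by fastforce
  then show ?thesis by (intro coord_eqI) simp
qed

lemma dominant_regular_eq_rho:
  assumes dom: "\<And>\<alpha>. \<alpha> \<in> \<Pi> \<Longrightarrow> ip q \<alpha> > 0"
    and \<Gamma>: "\<Gamma> \<subseteq> \<Delta>" and sp: "span \<Gamma> = UNIV"
    and one: "\<And>\<gamma>. \<gamma> \<in> \<Gamma> \<Longrightarrow> ip q \<gamma> = 1"
  shows "q = rho"
proof -
  have posr: "ip q \<beta> > 0" if "\<beta> \<in> pos_roots" for \<beta>
  proof -
    have "ip q \<beta> \<ge> 0" using dom that by (intro ip_dominant_nonneg) (auto simp: pos_roots_iff)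
    moreover have "ip q \<beta> \<noteq> 0"
      using ip_dominant_eq_0[OF dom, of \<beta>] that roots_nonzero by (auto simp: pos_roots_iff)
    ultimately show ?thesis by simp
  qed
  have reg: "ip q \<beta> \<noteq> 0" if "\<beta> \<in> \<Delta>" for \<beta>
    using root_pos_or_neg[OF that] posr[of \<beta>] posr[of "- \<beta>"] by auto
  have \<Gamma>_pos: "\<gamma> \<in> pos_roots" if "\<gamma> \<in> \<Gamma>" for \<gamma>
    using root_pos_or_neg[of \<gamma>] posr[of "- \<gamma>"] one[OF that] that \<Gamma> by fastforce
  \<comment> \<open>\<open>\<Gamma>\<close> spans; this is applied both to coordinates and to the
    functional built from the colouring.\<close>
  have vanish: "f v = 0" if "\<And>x y. f (x + y) = f x + f y" "\<And>c x. f (c *s x) = c * f x"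
    "\<And>\<gamma>. \<gamma> \<in> \<Gamma> \<Longrightarrow> f \<gamma> = 0" for f :: "'v \<Rightarrow> rat" and v
  proof -
    have "subspace {v. f v = 0}"
      unfolding subspace_def using that(1,2) that(2)[of 0 0] by auto
    then have "span \<Gamma> \<subseteq> {v. f v = 0}" using that(3) by (intro span_minimal) auto
    then show ?thesis using sp by blast
  qed
  \<comment> \<open>Since \<open>coord \<alpha>\<close> is not the zero functional,
    \<open>\<alpha>\<close> occurs in some \<open>\<gamma>\<close> of value 1, so its own value is
    at most 1; half-integrality leaves two possibilities.\<close>
  have half: "ip q \<alpha> = 1 \<or> ip q \<alpha> = 1 / 2" if a: "\<alpha> \<in> \<Pi>" for \<alpha>
  proof -
    obtain \<gamma> where g: "\<gamma> \<in> \<Gamma>" "coord \<alpha> \<gamma> \<noteq> 0"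
      using vanish[of "coord \<alpha>" \<alpha>] a by (auto simp: coord_simple)
    have gp: "\<gamma> \<in> pos_roots" using \<Gamma>_pos g by blast
    have "coord \<alpha> \<gamma> \<in> \<int>" "coord \<alpha> \<gamma> \<ge> 0" using coord_root_int pos_root gp a by (auto simp: pos_roots_iff)
    then have "coord \<alpha> \<gamma> \<ge> 1" using g(2) by (auto elim!: Ints_cases)
    then have "ip q (\<gamma> - \<alpha>) \<ge> 0"
      using gp a dom by (intro ip_dominant_nonneg) (auto simp: pos_roots_iff coord_simple)
    then have "ip q \<alpha> \<le> 1" using one[OF g(1)] by (simp add: ip_diff)
    moreover obtain n :: int where n: "2 * ip q \<alpha> = of_int n"
      using half_integral[OF \<Gamma> sp reg one] simple_root[OF a] Ints_cases by metis
    moreover have "n > 0" using dom[OF a] n by (metis of_int_0_less_iff zero_less_mult_iff zero_less_numeral)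
    ultimately have "n \<le> 2" "n > 0" by linarith+
    then have "n = 1 \<or> n = 2" by auto
    then show ?thesis using n by auto
  qed
  define S where "S = {\<alpha> \<in> \<Pi>. ip q \<alpha> = 1 / 2}"
  have "S = {}"
  proof (rule ccontr)
    assume "S \<noteq> {}"
    then obtain \<sigma> where \<sigma>: "\<sigma> \<in> S" by blast
    have S: "S \<subseteq> \<Pi>" "finite S" using finite_Basis by (auto simp: S_def)
    obtain c :: "'v \<Rightarrow> rat" where c: "\<And>\<alpha>. c \<alpha> \<noteq> 0"
      "\<And>\<alpha> \<beta>. \<alpha> \<in> S \<Longrightarrow> \<beta> \<in> S \<Longrightarrow> \<alpha> \<noteq> \<beta> \<Longrightarrow> ip \<alpha> \<beta> \<noteq> 0 \<Longrightarrow> c \<alpha> + c \<beta> = 0"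
      using simple_roots_two_colouring[OF S(1)] by blast
    \<comment> \<open>Nonzero at \<open>\<sigma>\<close>, yet vanishing on \<open>\<Gamma>\<close>:
      a member of \<open>\<Gamma>\<close> is a simple root outside \<open>S\<close> or a sum of two
      adjacent ones in \<open>S\<close>, whose colours cancel.\<close>
    define f where "f v = (\<Sum>\<alpha>\<in>S. c \<alpha> * coord \<alpha> v)" for v
    have f_add: "f (x + y) = f x + f y" for x y by (simp add: f_def distrib_left sum.distrib)
    have f_scale: "f (k *s x) = k * f x" for k x by (simp add: f_def sum_distrib_left mult.left_commute)
    have f_simple: "f \<alpha> = (if \<alpha> \<in> S then c \<alpha> else 0)" if "\<alpha> \<in> \<Pi>" for \<alpha>
    proof -
      have "f \<alpha> = (\<Sum>\<beta>\<in>S. if \<beta> = \<alpha> then c \<alpha> else 0)"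
        unfolding f_def using that by (intro sum.cong) (auto simp: coord_simple)
      then show ?thesis using S(2) by simp
    qed
    have "f \<gamma> = 0" if g: "\<gamma> \<in> \<Gamma>" for \<gamma>
    proof -
      have gp: "\<gamma> \<in> pos_roots" using \<Gamma>_pos g by blast
      have gi: "coord \<alpha> \<gamma> \<in> \<int>" if "\<alpha> \<in> \<Pi>" for \<alpha> using coord_root_int pos_root gp that by blast
      obtain \<alpha> where a: "\<alpha> \<in> \<Pi>" "coord \<alpha> \<gamma> > 0" using pos_root_coord_pos[OF gp] by blast
      have a1: "coord \<alpha> \<gamma> \<ge> 1" using a gi[OF a(1)] by (auto elim!: Ints_cases)
      have d_nn: "coord \<beta> (\<gamma> - \<alpha>) \<ge> 0" if "\<beta> \<in> \<Pi>" for \<beta>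
        using gp a a1 that by (auto simp: pos_roots_iff coord_simple)
      have d_ip: "ip q (\<gamma> - \<alpha>) = 1 - ip q \<alpha>" using one[OF g] by (simp add: ip_diff)
      show ?thesis
      proof (cases "ip q \<alpha> = 1")
        case True
        then have "\<gamma> - \<alpha> = 0" using ip_dominant_eq_0[OF dom d_nn] d_ip by simp
        then show ?thesis using f_simple[OF a(1)] True by (simp add: S_def)
      next
        case False
        then have h: "ip q \<alpha> = 1 / 2" using half[OF a(1)] by simp
        have "\<gamma> - \<alpha> \<noteq> 0" using d_ip h by auto
        then obtain \<beta> where b: "\<beta> \<in> \<Pi>" "coord \<beta> (\<gamma> - \<alpha>) \<noteq> 0"
          using coord_eqI[of "\<gamma> - \<alpha>" 0] by auto
        have "coord \<beta> (\<gamma> - \<alpha>) \<in> \<int>" using gi[OF b(1)] a(1) by (simp add: coord_simple)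
        then have b1: "coord \<beta> (\<gamma> - \<alpha>) \<ge> 1" using b(2) d_nn[OF b(1)] by (auto elim!: Ints_cases)
        have e_nn: "coord \<delta> (\<gamma> - \<alpha> - \<beta>) \<ge> 0" if "\<delta> \<in> \<Pi>" for \<delta>
          using d_nn[OF that] b1 b(1) by (auto simp: coord_simple[OF b(1)])
        have e_ip: "ip q (\<gamma> - \<alpha> - \<beta>) = 1 / 2 - ip q \<beta>"
          using d_ip h ip_diff(2)[of q "\<gamma> - \<alpha>" \<beta>] by simp
        \<comment> \<open>A nonnegative remainder excludes the value 1 for \<open>\<beta>\<close>;
          with value 1/2 nothing remains.\<close>
        have "ip q (\<gamma> - \<alpha> - \<beta>) \<ge> 0" using dom e_nn by (rule ip_dominant_nonneg)
        then have hb: "ip q \<beta> = 1 / 2" using half[OF b(1)] e_ip by auto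
        then have "\<gamma> - \<alpha> - \<beta> = 0" using ip_dominant_eq_0[OF dom e_nn] e_ip by simp
        then have eq: "\<gamma> = \<alpha> + \<beta>" by (simp add: algebra_simps)
        have rt: "\<gamma> \<in> \<Delta>" "\<alpha> \<in> \<Delta>" "\<beta> \<in> \<Delta>" using pos_root[OF gp] simple_root a b by auto
        have ne: "\<alpha> \<noteq> \<beta>"
        proof
          assume "\<alpha> = \<beta>"
          then have "\<gamma> = 2 *s \<alpha>" using eq scale_left_distrib[of 1 1 \<alpha>] by simp
          then show False using roots_reduced[of \<alpha> 2] rt by simp
        qed
        \<comment> \<open>If they were orthogonal, reflecting \<open>\<alpha> + \<beta>\<close> in
          \<open>\<beta>\<close> would give a root with coordinates of both signs.\<close>
        have "ip \<alpha> \<beta> \<noteq> 0"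
        proof
          assume "ip \<alpha> \<beta> = 0"
          then have "reflection \<beta> \<gamma> = \<alpha> - \<beta>"
            using reflection_self[of \<beta>] eq roots_nonzero rt
            by (auto simp: reflection_def ip_linear scale_left_distrib[of 1 1 \<beta>, simplified])
          then have d: "\<alpha> - \<beta> \<in> \<Delta>" using root_reflection[OF rt(3,1)] by simp
          then show False
            using root_pos_or_neg[OF d] a(1) b(1) ne by (force simp: pos_roots_iff coord_simple)
        qed
        then have "c \<alpha> + c \<beta> = 0" using c(2) ne a(1) b(1) h hb by (simp add: S_def)
        then show ?thesis using f_simple a(1) b(1) h hb by (simp add: eq f_add S_def)
      qed
    qed
    then have "f \<sigma> = 0" using vanish[of f] f_add f_scale by blast
    then show False using f_simple[of \<sigma>] \<sigma> S c(1)[of \<sigma>] by auto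
  qed
  then have "ip (q - rho) \<alpha> = 0" if "\<alpha> \<in> \<Pi>" for \<alpha>
    using half[OF that] that by (auto simp: S_def ip_diff ip_rho height_simple)
  then have "q - rho = 0" by (rule ip_nondegenerate)
  then show ?thesis by simp
qed

subsection \<open>The Weyl group and the coroot lattice\<close>

lemma weyl_linear:
  assumes "v \<in> weyl" shows "v (x + y) = v x + v y" "v (c *s x) = c *s v x"
proof -
  have "(\<forall>x y. v (x + y) = v x + v y) \<and> (\<forall>c x. v (c *s x) = c *s v x)"
    using assms unfolding weyl_def
  proof (induction v rule: refl_group.induct)
    case (step s w)
    then obtain \<alpha> where "s = reflection \<alpha>" by blast
    then show ?case using step.IH
      by (simp add: reflection_coroot ip_linear scale_left_distrib scale_right_diff_distrib)
  qed auto
  then show "v (x + y) = v x + v y" "v (c *s x) = c *s v x" by blast+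
qed

lemma weyl_zero: "v \<in> weyl \<Longrightarrow> v 0 = 0"
  using weyl_linear(2)[of v 0 0] by simp

lemma weyl_sum: "v \<in> weyl \<Longrightarrow> v (\<Sum>i\<in>A. f i) = (\<Sum>i\<in>A. v (f i))"
  by (induction A rule: infinite_finite_induct) (simp_all add: weyl_zero weyl_linear)

lemma weyl_ip: "v \<in> weyl \<Longrightarrow> ip (v x) (v y) = ip x y"
  unfolding weyl_def by (induction v rule: refl_group.induct) (auto simp: ip_reflection)

lemma weyl_root: "v \<in> weyl \<Longrightarrow> \<beta> \<in> \<Delta> \<Longrightarrow> v \<beta> \<in> \<Delta>"
  unfolding weyl_def by (induction v rule: refl_group.induct) (auto simp: root_reflection)

lemma weyl_inverse:
  assumes "v \<in> weyl"
  obtains u where "u \<in> weyl" "\<And>x. u (v x) = x" "\<And>x. v (u x) = x"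
  using refl_group_inverse[of v "reflection ` \<Delta>"] assms reflection_reflection
  unfolding weyl_def by auto

lemma weyl_id: "id \<in> weyl"
  by (simp add: weyl_def refl_group.one)

lemma weyl_comp: "u \<in> weyl \<Longrightarrow> v \<in> weyl \<Longrightarrow> u \<circ> v \<in> weyl"
  unfolding weyl_def by (rule refl_group_comp)

lemma weyl_reflection: "\<alpha> \<in> \<Delta> \<Longrightarrow> reflection \<alpha> \<in> weyl"
  unfolding weyl_def by (intro refl_group_generator imageI)

section \<open>The coroot lattice\<close>

lemma coroot_lattice_zero: "0 \<in> coroot_lattice"
  unfolding coroot_lattice_def by (auto intro!: exI[of _ "\<lambda>_. 0"])

lemma coroot_lattice_add: "x \<in> coroot_lattice \<Longrightarrow> y \<in> coroot_lattice \<Longrightarrow> x + y \<in> coroot_lattice"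
proof -
  assume "x \<in> coroot_lattice" "y \<in> coroot_lattice"
  then obtain m n :: "'v \<Rightarrow> int" where "x = (\<Sum>\<alpha>\<in>\<Pi>. of_int (m \<alpha>) *s coroot \<alpha>)"
    "y = (\<Sum>\<alpha>\<in>\<Pi>. of_int (n \<alpha>) *s coroot \<alpha>)" by (auto simp: coroot_lattice_def)
  then have "x + y = (\<Sum>\<alpha>\<in>\<Pi>. of_int (m \<alpha> + n \<alpha>) *s coroot \<alpha>)"
    by (simp add: scale_left_distrib sum.distrib)
  then show ?thesis unfolding coroot_lattice_def mem_Collect_eq by (rule exI[of _ "\<lambda>\<alpha>. m \<alpha> + n \<alpha>"])
qed

lemma coroot_lattice_scale: "x \<in> coroot_lattice \<Longrightarrow> c \<in> \<int> \<Longrightarrow> c *s x \<in> coroot_lattice"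
proof -
  assume "x \<in> coroot_lattice" "c \<in> \<int>"
  then obtain n :: "'v \<Rightarrow> int" and k :: int where "x = (\<Sum>\<alpha>\<in>\<Pi>. of_int (n \<alpha>) *s coroot \<alpha>)"
    "c = of_int k" by (auto simp: coroot_lattice_def elim!: Ints_cases)
  then have "c *s x = (\<Sum>\<alpha>\<in>\<Pi>. of_int (k * n \<alpha>) *s coroot \<alpha>)"
    by (simp add: scale_sum_right)
  then show ?thesis unfolding coroot_lattice_def mem_Collect_eq by (rule exI[of _ "\<lambda>\<alpha>. k * n \<alpha>"])
qed

lemma coroot_lattice_minus: "x \<in> coroot_lattice \<Longrightarrow> - x \<in> coroot_lattice"
  using coroot_lattice_scale[of x "-1"] by simp

lemma coroot_lattice_diff: "x \<in> coroot_lattice \<Longrightarrow> y \<in> coroot_lattice \<Longrightarrow> x - y \<in> coroot_lattice"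
  using coroot_lattice_add[of x "- y"] coroot_lattice_minus[of y] by simp

lemma coroot_minus: "coroot (- \<beta>) = - coroot \<beta>"
  by (simp add: coroot_def)

lemma coroot_reflection:
  assumes "\<alpha> \<in> \<Delta>" shows "coroot (reflection \<alpha> \<beta>) = reflection \<alpha> (coroot \<beta>)"
  using assms by (simp add: coroot_def ip_reflection weyl_linear(2) weyl_reflection)

lemma simple_coroot_lattice: "\<alpha> \<in> \<Pi> \<Longrightarrow> coroot \<alpha> \<in> coroot_lattice"
proof -
  assume a: "\<alpha> \<in> \<Pi>"
  have "(\<Sum>\<beta>\<in>\<Pi>. of_int (if \<beta> = \<alpha> then 1 else 0) *s coroot \<beta>)
      = (\<Sum>\<beta>\<in>\<Pi>. if \<beta> = \<alpha> then coroot \<alpha> else 0)"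
    by (intro sum.cong) auto
  then have "coroot \<alpha> = (\<Sum>\<beta>\<in>\<Pi>. of_int (if \<beta> = \<alpha> then 1 else 0) *s coroot \<beta>)"
    using a finite_Basis by simp
  then show ?thesis unfolding coroot_lattice_def mem_Collect_eq
    by (rule exI[of _ "\<lambda>\<beta>. if \<beta> = \<alpha> then 1 else 0"])
qed

text \<open>Reflection commutes with forming coroots and changes \<open>coroot \<beta>\<close> by an
  integral multiple of \<open>coroot \<alpha>\<close>.\<close>

lemma reflection_coroot_lattice:
  assumes "\<alpha> \<in> \<Delta>" "coroot \<alpha> \<in> coroot_lattice" "\<beta> \<in> \<Delta>" "coroot \<beta> \<in> coroot_lattice"
  shows "coroot (reflection \<alpha> \<beta>) \<in> coroot_lattice"
proof -
  have "ip (coroot \<beta>) \<alpha> \<in> \<int>" using ip_coroot_int[OF assms(3,1)] by (simp add: ip_sym)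
  then show ?thesis
    unfolding coroot_reflection[OF assms(1)] reflection_coroot[of \<alpha> "coroot \<beta>"]
    by (intro coroot_lattice_diff coroot_lattice_scale assms)
qed

text \<open>Induction on the height: for non-simple \<open>\<beta>\<close> a simple reflection with
  positive pairing produces a lower positive root, and the same reflection brings it back.\<close>

lemma pos_coroot_lattice:
  "\<beta> \<in> pos_roots \<Longrightarrow> height \<beta> \<le> of_nat n \<Longrightarrow> coroot \<beta> \<in> coroot_lattice"
proof (induction n arbitrary: \<beta>)
  case 0
  then show ?case using height_pos_root[of \<beta>] by simp
next
  case (Suc n)
  show ?case
  proof (cases "\<beta> \<in> \<Pi>")
    case False
    obtain \<alpha> where a: "\<alpha> \<in> \<Pi>" "ip \<beta> \<alpha> > 0" using pos_root_decompose[OF Suc.prems(1) False] by blast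
    have r: "\<alpha> \<in> \<Delta>" "\<beta> \<in> \<Delta>" using simple_root a pos_root Suc.prems by auto
    let ?b = "reflection \<alpha> \<beta>"
    have b: "?b \<in> \<Delta>" using root_reflection r by blast
    obtain \<alpha>' where "\<alpha>' \<in> \<Pi>" "\<alpha>' \<noteq> \<alpha>" "coord \<alpha>' \<beta> > 0"
      using pos_root_not_simple[OF Suc.prems(1) a(1)] False a(1) by metis
    then have bp: "?b \<in> pos_roots"
      using pos_root_if_coord_pos[OF b, of \<alpha>'] a(1) by (simp add: reflection_def coord_simple)
    have "ip \<beta> (coroot \<alpha>) > 0" using a(2) ip_root_pos[OF r(1)] by (simp add: ip_coroot)
    then have "ip \<beta> (coroot \<alpha>) \<ge> 1" using ip_coroot_int[OF r] by (auto elim!: Ints_cases)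
    then have "height ?b \<le> of_nat n"
      using Suc.prems(2) a(1) by (simp add: reflection_coroot' height_simple)
    then have "coroot ?b \<in> coroot_lattice" using Suc.IH bp by blast
    then have "coroot (reflection \<alpha> ?b) \<in> coroot_lattice"
      using reflection_coroot_lattice[of \<alpha> ?b] r(1) b simple_coroot_lattice[OF a(1)] by blast
    then show ?thesis using reflection_reflection[OF r(1)] by simp
  qed (rule simple_coroot_lattice)
qed

lemma root_coroot_lattice: "\<beta> \<in> \<Delta> \<Longrightarrow> coroot \<beta> \<in> coroot_lattice"
proof -
  have pos: "coroot \<gamma> \<in> coroot_lattice" if "\<gamma> \<in> pos_roots" for \<gamma>
    using pos_coroot_lattice[OF that] reals_Archimedean2[of "height \<gamma>"] by (blast intro: less_imp_le)
  assume "\<beta> \<in> \<Delta>"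
  then show ?thesis
    using root_pos_or_neg[of \<beta>] pos[of \<beta>] pos[of "- \<beta>"] coroot_lattice_minus[of "coroot (- \<beta>)"]
    by (auto simp: coroot_minus)
qed

lemma coroot_lattice_ip_int:
  assumes "r \<in> coroot_lattice" "\<beta> \<in> \<Delta>" shows "ip r \<beta> \<in> \<int>"
proof -
  obtain n :: "'v \<Rightarrow> int" where r: "r = (\<Sum>\<alpha>\<in>\<Pi>. of_int (n \<alpha>) *s coroot \<alpha>)"
    using assms(1) by (auto simp: coroot_lattice_def)
  show ?thesis
    unfolding r ip_sum using assms(2) ip_coroot_int simple_root
    by (intro Ints_sum) (auto simp: ip_sym[of _ \<beta>] ip_scale_right intro!: Ints_mult)
qed

lemma weyl_coroot_lattice: "v \<in> weyl \<Longrightarrow> r \<in> coroot_lattice \<Longrightarrow> v r \<in> coroot_lattice"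
  unfolding weyl_def
proof (induction v rule: refl_group.induct)
  case (step s w)
  then obtain \<alpha> where a: "\<alpha> \<in> \<Delta>" "s = reflection \<alpha>" by blast
  have w: "w r \<in> coroot_lattice" using step by blast
  then show ?case
    using a by (auto simp: reflection_coroot intro!: coroot_lattice_diff coroot_lattice_scale
        root_coroot_lattice coroot_lattice_ip_int)
qed auto

subsection \<open>The affine Weyl group\<close>

definition aroots :: "('v \<times> rat \<times> rat) set" where
  "aroots = {(\<beta>, k, 0) | \<beta> k. \<beta> \<in> \<Delta> \<and> k \<in> \<int>}"

text \<open>Reads \<open>(\<beta>, k, 0)\<close> as the affine function
  \<open>ip x \<beta> + k\<close> and evaluates it at the centre; the entry 1 picks up
  \<open>k\<close>.\<close>

definition center_value :: "'v \<times> rat \<times> rat \<Rightarrow> rat" where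
  "center_value b = aip b (center, 0, 1)"

lemma h_pos: "h > 0"
  using coxeter_number_ge_2 by simp

lemma center_value_root: "center_value (\<beta>, k, 0) = height \<beta> / h + k"
  by (simp add: center_value_def ip_sym[of \<beta> center] ip_center)

lemma center_value_linear [simp]:
  "center_value (b + c) = center_value b + center_value c" "center_value (- b) = - center_value b"
  by (cases b; cases c; simp add: center_value_def ip_linear algebra_simps)+

lemma aroot_minus: "b \<in> aroots \<Longrightarrow> - b \<in> aroots"
  by (force simp: aroots_def uminus_prod_def intro: root_minus)

text \<open>Heights of roots stay strictly between \<open>- h\<close> and \<open>h\<close>, so the
  coefficient \<open>k\<close> decides the sign unless it is 0.\<close>

lemma center_value_pos_iff:
  assumes "\<beta> \<in> \<Delta>" "k \<in> \<int>"
  shows "center_value (\<beta>, k, 0) > 0 \<longleftrightarrow> k \<ge> 1 \<or> (k = 0 \<and> \<beta> \<in> pos_roots)"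
proof -
  obtain n :: int where n: "k = of_int n" using assms(2) Ints_cases by blast
  have val: "height \<beta> / h + k > 0 \<longleftrightarrow> height \<beta> + k * h > 0" using h_pos by (simp add: field_simps)
  consider "n \<ge> 1" | "n = 0" | "n \<le> -1" by linarith
  then show ?thesis
  proof cases
    case 1
    then have "k \<ge> 1" using n by simp
    then have "k * h \<ge> 1 * h" using h_pos by (intro mult_right_mono) auto
    then show ?thesis using height_ge_lowest[OF assms(1)] \<open>k \<ge> 1\<close>
      unfolding center_value_root val by simp
  next
    case 2
    then show ?thesis using n pos_root_iff_height[OF assms(1)] unfolding center_value_root val by simp
  next
    case 3
    then have "k \<le> -1" using n by simp
    then have "k * h \<le> (-1) * h" using h_pos by (intro mult_right_mono) auto
    then show ?thesis using height_le_highest[OF assms(1)] \<open>k \<le> -1\<close>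
      unfolding center_value_root val by simp
  qed
qed

text \<open>Positivity becomes a sign at one point of the alcove, so it can be tracked through
  isometries.\<close>

lemma apos_roots_iff: "b \<in> apos_roots \<longleftrightarrow> b \<in> aroots \<and> center_value b > 0"
proof
  assume "b \<in> apos_roots"
  then consider \<beta> where "\<beta> \<in> pos_roots" "b = (\<beta>, 0, 0)"
    | \<beta> k where "\<beta> \<in> \<Delta>" "k \<ge> 1" "b = (\<beta>, of_int k, 0)"
    by (auto simp: apos_roots_def emb_def delta_def)
  then show "b \<in> aroots \<and> center_value b > 0"
  proof cases
    case 1
    then show ?thesis using pos_root[of \<beta>] center_value_pos_iff[of \<beta> 0] by (auto simp: aroots_def)
  next
    case 2
    then show ?thesis using center_value_pos_iff[of \<beta> "of_int k"] by (auto simp: aroots_def)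
  qed
next
  assume "b \<in> aroots \<and> center_value b > 0"
  then obtain \<beta> and n :: int where b: "b = (\<beta>, of_int n, 0)" "\<beta> \<in> \<Delta>" "center_value b > 0"
    by (auto simp: aroots_def elim!: Ints_cases)
  then have "n \<ge> 1 \<or> (n = 0 \<and> \<beta> \<in> pos_roots)"
    using center_value_pos_iff[of \<beta> "of_int n"] by simp
  then show "b \<in> apos_roots"
  proof
    assume "n \<ge> 1"
    then show ?thesis using b unfolding apos_roots_def
      by (intro UnI2) (auto simp: emb_def delta_def intro!: exI[of _ \<beta>] exI[of _ n])
  next
    assume "n = 0 \<and> \<beta> \<in> pos_roots"
    then show ?thesis using b unfolding apos_roots_def by (intro UnI1) (auto simp: emb_def)
  qed
qed

text \<open>The discreteness behind the descents towards the centre: times \<open>h\<close>, the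
  value is the integer \<open>height \<beta> + h * k\<close>, nonzero since the root or its negative
  is positive.\<close>

lemma aroot_center_value:
  assumes "b \<in> aroots"
  shows "h * center_value b \<in> \<int>" "center_value b \<noteq> 0"
proof -
  obtain \<beta> k where b: "b = (\<beta>, k, 0)" "\<beta> \<in> \<Delta>" "k \<in> \<int>" using assms by (auto simp: aroots_def)
  have eq: "h * center_value b = height \<beta> + h * k"
    using h_pos by (simp add: b center_value_root field_simps)
  then show "h * center_value b \<in> \<int>"
    using height_root_int[OF b(2)] coxeter_number_int b(3) by simp
  show "center_value b \<noteq> 0"
  proof (cases "k \<ge> 1 \<or> (k = 0 \<and> \<beta> \<in> pos_roots)")
    case True
    then show ?thesis using center_value_pos_iff[OF b(2,3)] b by simp
  next
    case False
    then have "- k \<ge> 1 \<or> (- k = 0 \<and> - \<beta> \<in> pos_roots)"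
      using b(3) root_pos_or_neg[OF b(2)] by (auto elim!: Ints_cases)
    then have "center_value (- \<beta>, - k, 0) > 0"
      using center_value_pos_iff[of "- \<beta>" "- k"] root_minus b by simp
    then show ?thesis by (simp add: b center_value_root)
  qed
qed

lemma aroot_pos_or_neg: "b \<in> aroots \<Longrightarrow> b \<in> apos_roots \<or> - b \<in> apos_roots"
  using aroot_center_value(2)[of b] aroot_minus[of b] by (auto simp: apos_roots_iff)

lemma uminus_apos_roots_iff: "b \<in> uminus ` apos_roots \<longleftrightarrow> b \<in> aroots \<and> center_value b < 0"
proof -
  have "b \<in> uminus ` apos_roots \<longleftrightarrow> - b \<in> apos_roots"
    by (metis (no_types, lifting) image_iff minus_minus)
  then show ?thesis using aroot_minus[of b] aroot_minus[of "- b"] by (auto simp: apos_roots_iff)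
qed

lemma asimple_roots_eq: "asimple_roots = (\<lambda>e. (e, level e, 0)) ` ext_simple"
proof -
  have "asimple_roots = insert (- \<theta>, level (- \<theta>), 0) ((\<lambda>\<alpha>. (\<alpha>, 0, 0)) ` \<Pi>)"
    by (simp add: asimple_roots_def delta_def emb_def level_def)
  also have "(\<lambda>\<alpha>. (\<alpha>, 0::rat, 0::rat)) ` \<Pi> = (\<lambda>e. (e, level e, 0)) ` \<Pi>"
    by (intro image_cong) (simp_all add: level_mark_simple)
  finally show ?thesis by (simp add: ext_simple_def)
qed

lemma center_value_asimple: "e \<in> ext_simple \<Longrightarrow> center_value (e, level e, 0) = 1 / h"
  using ext_simple_center[of e] by (simp add: center_value_root ip_center)

lemma asimple_apos: "a \<in> asimple_roots \<Longrightarrow> a \<in> apos_roots"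
  using center_value_asimple h_pos ext_simple_root level_int
  by (auto simp: asimple_roots_eq apos_roots_iff aroots_def)

lemma asimple_aroot: "a \<in> asimple_roots \<Longrightarrow> a \<in> aroots"
  using asimple_apos by (simp add: apos_roots_iff)

text \<open>The semidirect product of Weyl group and coroot lattice, identified with
  \<open>affine_weyl\<close> in \<open>affine_weyl_eq\<close>.\<close>

definition weyl_translations :: "('v \<times> rat \<times> rat \<Rightarrow> 'v \<times> rat \<times> rat) set" where
  "weyl_translations = {lift v \<circ> translation r | v r. v \<in> weyl \<and> r \<in> coroot_lattice}"

text \<open>Both sides move \<open>(x, a, b)\<close> by the same multiple \<open>m\<close> of the
  root; the quadratic term of \<open>translation\<close> supplies the part of \<open>m * k\<close>
  proportional to \<open>b\<close>.\<close>

lemma areflection_eq: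
  assumes "\<beta> \<in> \<Delta>"
  shows "areflection (\<beta>, k, 0) = lift (reflection \<beta>) \<circ> translation (k *s coroot \<beta>)"
proof (rule ext, clarify)
  fix x a b
  let ?n = "ip \<beta> \<beta>"
  have n: "?n \<noteq> 0" using assms roots_nonzero by auto
  define m where "m = 2 * (ip x \<beta> + k * b) / ?n"
  have cb: "ip (coroot \<beta>) \<beta> = 2" using n by (simp add: coroot_def ip_scale)
  have 1: "reflection \<beta> (x + b *s (k *s coroot \<beta>)) = x - m *s \<beta>"
  proof -
    have "reflection \<beta> (x + b *s (k *s coroot \<beta>))
        = x + (b * k * (2 / ?n)) *s \<beta> - (2 * (ip x \<beta> + b * k * 2) / ?n) *s \<beta>"
      by (simp only: reflection_def ip_linear cb) (simp add: coroot_def)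
    also have "\<dots> = x - (2 * (ip x \<beta> + b * k * 2) / ?n - b * k * (2 / ?n)) *s \<beta>"
      by (simp add: scale_left_diff_distrib)
    also have "2 * (ip x \<beta> + b * k * 2) / ?n - b * k * (2 / ?n) = m"
      by (simp add: m_def diff_divide_distrib[symmetric] algebra_simps)
    finally show ?thesis .
  qed
  have "ip (k *s coroot \<beta>) (k *s coroot \<beta>) = 4 * k * k / ?n"
    using n by (simp add: ip_linear coroot_def)
  moreover have "ip x (k *s coroot \<beta>) = k * (2 * ip x \<beta> / ?n)"
    by (simp only: ip_scale_right ip_coroot)
  ultimately have 2: "a - (ip x (k *s coroot \<beta>) + ip (k *s coroot \<beta>) (k *s coroot \<beta>) * b / 2) = a - m * k"
    by (simp only:) (simp add: m_def add_divide_distrib algebra_simps)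
  have 3: "areflection (\<beta>, k, 0) (x, a, b) = (x - m *s \<beta>, a - m * k, b)"
    by (simp add: areflection_def m_def mult.commute)
  show "areflection (\<beta>, k, 0) (x, a, b)
      = (lift (reflection \<beta>) \<circ> translation (k *s coroot \<beta>)) (x, a, b)"
    by (simp only: comp_apply translation.simps lift.simps 1 2 3)
qed

lemma areflection_weyl_translations: "b \<in> aroots \<Longrightarrow> areflection b \<in> weyl_translations"
  unfolding aroots_def weyl_translations_def
  using areflection_eq weyl_reflection coroot_lattice_scale root_coroot_lattice by blast

lemma translation_add: "translation (r + s) = translation r \<circ> translation s"
  by (rule ext, clarify)
     (simp add: ip_linear ip_sym[of s r] scale_right_distrib add_divide_distrib algebra_simps)

lemma translation_lift:
  assumes "v \<in> weyl" shows "translation (v r) \<circ> lift v = lift v \<circ> translation r"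
  using assms by (intro ext) (auto simp: weyl_linear weyl_ip)

lemma weyl_translations_comp:
  assumes "f \<in> weyl_translations" "g \<in> weyl_translations" shows "f \<circ> g \<in> weyl_translations"
proof -
  obtain u r v s where f: "f = lift u \<circ> translation r" "u \<in> weyl" "r \<in> coroot_lattice"
    and g: "g = lift v \<circ> translation s" "v \<in> weyl" "s \<in> coroot_lattice"
    using assms by (auto simp: weyl_translations_def)
  obtain v' where v': "v' \<in> weyl" "\<And>x. v (v' x) = x" using weyl_inverse[OF g(2)] by blast
  have "f \<circ> g = lift u \<circ> (translation (v (v' r)) \<circ> lift v) \<circ> translation s"
    by (simp add: f g v' comp_assoc)
  also have "\<dots> = (lift u \<circ> lift v) \<circ> (translation (v' r) \<circ> translation s)"
    by (simp only: translation_lift[OF g(2)] comp_assoc)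
  also have "lift u \<circ> lift v = lift (u \<circ> v)" by (rule ext) auto
  finally have "f \<circ> g = lift (u \<circ> v) \<circ> translation (v' r + s)" by (simp only: translation_add)
  then show ?thesis
    unfolding weyl_translations_def
    using weyl_comp[OF f(2) g(2)] coroot_lattice_add[OF weyl_coroot_lattice[OF v'(1) f(3)] g(3)] by blast
qed

lemma weyl_translations_id: "id \<in> weyl_translations"
proof -
  have "id = lift id \<circ> translation 0" by (rule ext) auto
  then show ?thesis unfolding weyl_translations_def using weyl_id coroot_lattice_zero by blast
qed

lemma affine_weyl_subset: "affine_weyl \<subseteq> weyl_translations"
proof
  fix w assume "w \<in> affine_weyl"
  then show "w \<in> weyl_translations"
    unfolding affine_weyl_def
  proof (induction w rule: refl_group.induct)
    case (step s w)
    then have "s \<in> weyl_translations" using areflection_weyl_translations asimple_aroot by blast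
    then show ?case using step.IH by (rule weyl_translations_comp)
  qed (rule weyl_translations_id)
qed

lemma weyl_translations_linear:
  assumes "w \<in> weyl_translations"
  shows "w (x + y) = w x + w y" "w (ascale c x) = ascale c (w x)" "aip (w x) (w y) = aip x y"
proof -
  obtain v r where w: "w = lift v \<circ> translation r" "v \<in> weyl"
    using assms by (auto simp: weyl_translations_def)
  obtain x1 x2 x3 y1 y2 y3 where xy: "x = (x1, x2, x3)" "y = (y1, y2, y3)"
    by (cases x; cases y) auto
  show "w (x + y) = w x + w y"
    by (simp add: w xy weyl_linear ip_linear scale_left_distrib algebra_simps add_divide_distrib)
  show "w (ascale c x) = ascale c (w x)"
    by (simp add: w xy weyl_linear ip_linear scale_right_distrib algebra_simps)
  have "ip (v (x1 + x3 *s r)) (v (y1 + y3 *s r)) = ip (x1 + x3 *s r) (y1 + y3 *s r)"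
    using w by (simp only: weyl_ip)
  also have "\<dots> = ip x1 y1 + y3 * ip x1 r + x3 * ip y1 r + x3 * y3 * ip r r"
    by (simp add: ip_linear ip_sym[of r y1] algebra_simps)
  finally show "aip (w x) (w y) = aip x y"
    by (simp add: w xy algebra_simps)
qed

lemma weyl_translations_minus: "w \<in> weyl_translations \<Longrightarrow> w (- x) = - w x"
proof -
  assume w: "w \<in> weyl_translations"
  have "w 0 + w 0 = w 0 + 0" using weyl_translations_linear(1)[OF w, of 0 0] by simp
  then have "w 0 = 0" by (rule add_left_imp_eq)
  then have "w x + w (- x) = 0" using weyl_translations_linear(1)[OF w, of x "- x"] by simp
  then show ?thesis by (simp add: eq_neg_iff_add_eq_0 add.commute)
qed

lemma weyl_translations_diff: "w \<in> weyl_translations \<Longrightarrow> w (x - y) = w x - w y"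
  using weyl_translations_linear(1)[of w x "- y"] by (simp add: weyl_translations_minus)

lemma weyl_translations_aroot:
  assumes "w \<in> weyl_translations" "b \<in> aroots" shows "w b \<in> aroots"
proof -
  obtain v r where w: "w = lift v \<circ> translation r" "v \<in> weyl" "r \<in> coroot_lattice"
    using assms by (auto simp: weyl_translations_def)
  obtain \<beta> k where b: "b = (\<beta>, k, 0)" "\<beta> \<in> \<Delta>" "k \<in> \<int>" using assms by (auto simp: aroots_def)
  have "ip \<beta> r \<in> \<int>" using coroot_lattice_ip_int[OF w(3) b(2)] by (simp add: ip_sym)
  then show ?thesis using w b weyl_root by (auto simp: aroots_def)
qed

lemma areflection_conj:
  assumes "w \<in> weyl_translations" shows "w \<circ> areflection b = areflection (w b) \<circ> w"
  by (rule ext) (simp add: areflection_def weyl_translations_diff[OF assms] weyl_translations_linear[OF assms])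

lemma areflection_involution:
  assumes "b \<in> aroots" shows "areflection b (areflection b z) = z"
proof -
  obtain \<beta> k where b: "b = (\<beta>, k, 0)" "\<beta> \<in> \<Delta>" using assms by (auto simp: aroots_def)
  obtain x a c where z: "z = (x, a, c)" by (cases z)
  define m where "m = 2 * (ip x \<beta> + k * c) / ip \<beta> \<beta>"
  have n: "ip \<beta> \<beta> \<noteq> 0" using b(2) roots_nonzero by auto
  have 1: "areflection b z = (x - m *s \<beta>, a - m * k, c)"
    by (simp add: areflection_def b z m_def mult.commute)
  have "2 * (ip (x - m *s \<beta>) \<beta> + k * c) / ip \<beta> \<beta> = - m"
    using n by (simp add: ip_linear m_def field_simps)
  then show ?thesis by (simp add: 1) (simp add: areflection_def b z mult.commute)
qed

lemma areflection_self:
  assumes "b \<in> aroots" shows "areflection b b = - b"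
proof -
  obtain \<beta> k where b: "b = (\<beta>, k, 0)" "\<beta> \<in> \<Delta>" using assms by (auto simp: aroots_def)
  have "ip \<beta> \<beta> \<noteq> 0" using b(2) roots_nonzero by auto
  then show ?thesis using scale_left_distrib[of 1 1 \<beta>] by (simp add: areflection_def b)
qed

lemma areflection_minus: "areflection (- b) = areflection b"
proof
  fix z
  have "aip z (- b) = - aip z b" "aip (- b) (- b) = aip b b" "ascale (- c) (- b) = ascale c b" for c
    by (cases b; cases z; simp add: algebra_simps)+
  then show "areflection (- b) z = areflection b z" by (simp add: areflection_def)
qed

lemma areflection_root:
  assumes "e \<in> \<Delta>"
  shows "areflection (e, l, 0) (\<beta>, k, 0) = (reflection e \<beta>, k - ip \<beta> (coroot e) * l, 0)"
  by (simp add: areflection_def reflection_def ip_coroot)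

section \<open>Generation of the affine Weyl group by its simple reflections\<close>

lemma affine_weyl_id: "id \<in> affine_weyl"
  unfolding affine_weyl_def by (rule refl_group.one)

lemma affine_weyl_comp: "u \<in> affine_weyl \<Longrightarrow> w \<in> affine_weyl \<Longrightarrow> u \<circ> w \<in> affine_weyl"
  unfolding affine_weyl_def by (rule refl_group_comp)

lemma affine_weyl_areflection: "a \<in> asimple_roots \<Longrightarrow> areflection a \<in> affine_weyl"
  unfolding affine_weyl_def by (intro refl_group_generator imageI)

lemma affine_weyl_inverse:
  assumes "w \<in> affine_weyl"
  obtains u where "u \<in> affine_weyl" "\<And>x. u (w x) = x" "\<And>x. w (u x) = x"
proof -
  have "s (s x) = x" if "s \<in> areflection ` asimple_roots" for s x
    using that areflection_involution asimple_aroot by blast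
  then have "\<exists>u\<in>affine_weyl. (\<forall>x. u (w x) = x) \<and> (\<forall>x. w (u x) = x)"
    using assms unfolding affine_weyl_def by (intro refl_group_inverse)
  then show ?thesis using that by blast
qed

text \<open>For a finite simple root only one coordinate changes and another positive one persists.
  For \<open>\<delta> - \<theta>\<close> the height shift bounds the Cartan integer \<open>m\<close>
  by 2, and each value is checked against the extreme heights.\<close>

lemma asimple_reflection_pos:
  assumes a: "a \<in> asimple_roots" and b: "b \<in> apos_roots" and ne: "b \<noteq> a"
  shows "areflection a b \<in> apos_roots"
proof -
  obtain e where e: "e \<in> ext_simple" "a = (e, level e, 0)" using a by (auto simp: asimple_roots_eq)
  have er: "e \<in> \<Delta>" using ext_simple_root e by blast
  have "b \<in> aroots" using b by (simp add: apos_roots_iff)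
  then obtain \<beta> k where bk: "b = (\<beta>, k, 0)" "\<beta> \<in> \<Delta>" "k \<in> \<int>" by (auto simp: aroots_def)
  define m where "m = ip \<beta> (coroot e)"
  have m_int: "m \<in> \<int>" unfolding m_def using ip_coroot_int er bk by blast
  have r: "reflection e \<beta> \<in> \<Delta>" using root_reflection er bk by blast
  have s: "areflection a b = (reflection e \<beta>, k - m * level e, 0)"
    by (simp add: e bk areflection_root[OF er] m_def)
  have sr: "areflection a b \<in> aroots"
    unfolding s using r m_int bk(3) level_int by (auto simp: aroots_def)
  have kpos: "k \<ge> 1 \<or> (k = 0 \<and> \<beta> \<in> pos_roots)"
    using center_value_pos_iff bk b by (auto simp: apos_roots_iff)
  show ?thesis
  proof (cases "e = - \<theta>")
    case False
    then have ep: "e \<in> \<Pi>" "level e = 0" using e by (auto simp: ext_simple_def level_def)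
    have "k \<ge> 1 \<or> (k = 0 \<and> reflection e \<beta> \<in> pos_roots)"
    proof (cases "k \<ge> 1")
      case False
      then have k: "k = 0" "\<beta> \<in> pos_roots" using kpos by auto
      then have "\<beta> \<noteq> e" using ne bk e ep by auto
      then obtain \<alpha>' where "\<alpha>' \<in> \<Pi>" "\<alpha>' \<noteq> e" "coord \<alpha>' \<beta> > 0"
        using pos_root_not_simple k ep by metis
      then have "reflection e \<beta> \<in> pos_roots"
        using pos_root_if_coord_pos[OF r, of \<alpha>'] ep(1) by (simp add: reflection_def coord_simple)
      then show ?thesis using k by simp
    qed simp
    then show ?thesis using center_value_pos_iff[OF r bk(3)] sr by (simp add: s ep apos_roots_iff)
  next
    case True
    have l: "level e = 1" using True by (simp add: level_def)
    \<comment> \<open>Reflecting in \<open>- \<theta>\<close> adds \<open>m\<close> copies of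
      \<open>\<theta>\<close>, each of height \<open>h - 1\<close>.\<close>
    have ht: "height (reflection e \<beta>) = height \<beta> + m * (h - 1)"
      by (simp add: reflection_coroot' True m_def height_highest coroot_minus)
    have "m * (h - 1) \<le> (h - 1) - height \<beta>" using height_le_highest[OF r] ht by simp
    also have "\<dots> \<le> 2 * (h - 1)" using height_ge_lowest[OF bk(2)] by simp
    finally have "m * (h - 1) \<le> 2 * (h - 1)" .
    then have m2: "m \<le> 2" by (rule mult_right_le_imp_le) (use coxeter_number_ge_2 in simp)
    have "k - m \<ge> 1 \<or> (k - m = 0 \<and> reflection e \<beta> \<in> pos_roots)"
    proof (cases "k = 0")
      case True
      then have bp: "\<beta> \<in> pos_roots" using kpos by simp
      \<comment> \<open>With \<open>\<beta>\<close> positive, these values would lift the height to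
        at least \<open>h\<close>, above that of \<open>\<theta>\<close>.\<close>
      have "m \<noteq> 1" "m \<noteq> 2"
        using height_pos_root[OF bp] height_le_highest[OF r] ht coxeter_number_ge_2 by auto
      then have "m \<le> 0" using m2 m_int by (auto elim!: Ints_cases)
      moreover have "reflection e \<beta> = \<beta>" if "m = 0" using that by (simp add: reflection_coroot' m_def)
      ultimately show ?thesis using True bp m_int by (auto elim!: Ints_cases)
    next
      case False
      then have k1: "k \<ge> 1" using kpos by simp
      consider "m \<le> 0" | "m = 1" | "m = 2" using m2 m_int by (fastforce elim!: Ints_cases)
      then show ?thesis
      proof cases
        case 1
        then show ?thesis using k1 by simp
      next
        case 2
        have "height (reflection e \<beta>) \<ge> 0" using ht 2 height_ge_lowest[OF bk(2)] by simp
        then have "reflection e \<beta> \<in> pos_roots"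
          using pos_root_iff_height[OF r] height_root_nonzero[OF r] by simp
        then show ?thesis using k1 2 bk(3) by (auto elim!: Ints_cases)
      next
        case 3
        \<comment> \<open>The value 2 occurs only for \<open>\<beta> = - \<theta>\<close>; then
          \<open>b \<noteq> a\<close> forces \<open>k \<ge> 2\<close>, so \<open>k - m\<close> stays
          nonnegative.\<close>
        have ge: "height (reflection e \<beta>) \<ge> h - 1" using ht 3 height_ge_lowest[OF bk(2)] by simp
        then have hb: "height (- \<beta>) = h - 1" using ht 3 height_le_highest[OF r] by simp
        then have "\<beta> = e" using height_eq_highest[of "- \<beta>"] root_minus[OF bk(2)] True
          by (metis minus_minus)
        then have "k \<noteq> 1" using ne bk e l by auto
        moreover have "reflection e \<beta> \<in> pos_roots"
          using ge coxeter_number_ge_2 pos_root_iff_height[OF r] by simp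
        ultimately show ?thesis using k1 3 bk(3) by (auto elim!: Ints_cases)
      qed
    qed
    moreover have "k - m \<in> \<int>" using m_int bk by simp
    ultimately show ?thesis using center_value_pos_iff[OF r] sr by (simp add: s l apos_roots_iff)
  qed
qed

text \<open>Induction on \<open>h * center_value b\<close>, the height in terms of affine simple
  roots. A simple reflection with positive pairing lowers it, and conjugation by that reflection
  carries membership back.\<close>

lemma apos_reflection_affine_weyl:
  "b \<in> apos_roots \<Longrightarrow> h * center_value b \<le> of_nat n \<Longrightarrow> areflection b \<in> affine_weyl"
proof (induction n arbitrary: b)
  case 0
  then have "center_value b > 0" "h * center_value b \<le> 0" by (simp_all add: apos_roots_iff)
  then show ?case using h_pos by (simp add: mult_le_0_iff)
next
  case (Suc n)
  show ?case
  proof (cases "b \<in> asimple_roots")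
    case False
    have "b \<in> aroots" using Suc.prems by (simp add: apos_roots_iff)
    then obtain \<beta> k where b: "b = (\<beta>, k, 0)" "\<beta> \<in> \<Delta>" "k \<in> \<int>" by (auto simp: aroots_def)
    \<comment> \<open>Otherwise the linear relation with positive marks would make all pairings
      zero.\<close>
    have "\<exists>e\<in>ext_simple. ip \<beta> e > 0"
    proof (rule ccontr)
      assume "\<not> ?thesis"
      then have np: "ip \<beta> e \<le> 0" if "e \<in> ext_simple" for e using that by force
      have zero: "ip \<beta> e = 0" if g: "e \<in> ext_simple" for e
      proof -
        have "mark i * - ip \<beta> i \<ge> 0" if "i \<in> ext_simple" for i
          using np[OF that] mark_ge_1[OF that] by (intro mult_nonneg_nonneg) auto
        moreover have "(\<Sum>i\<in>ext_simple. mark i * - ip \<beta> i) = 0"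
          using sum_mark_ip[of \<beta>] by (simp add: sum_negf)
        ultimately have "\<forall>i\<in>ext_simple. mark i * - ip \<beta> i = 0"
          using sum_nonneg_eq_0_iff[OF finite_ext_simple, of "\<lambda>i. mark i * - ip \<beta> i"] by blast
        then show ?thesis using g mark_ge_1[OF g] by fastforce
      qed
      have "\<beta> = 0" using zero by (intro ip_nondegenerate) (simp add: ext_simple_def)
      then show False using b roots_nonzero by blast
    qed
    then obtain e where e: "e \<in> ext_simple" "ip \<beta> e > 0" by blast
    have er: "e \<in> \<Delta>" using ext_simple_root e by blast
    define a where "a = (e, level e, 0::rat)"
    have a: "a \<in> asimple_roots" using e by (simp add: asimple_roots_eq a_def)
    let ?m = "ip \<beta> (coroot e)"
    have "?m > 0" using e(2) ip_root_pos[OF er] by (simp add: ip_coroot)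
    then have m: "?m \<ge> 1" using ip_coroot_int[OF er b(2)] by (auto elim!: Ints_cases)
    define b' where "b' = areflection a b"
    have b': "b' \<in> apos_roots" unfolding b'_def using asimple_reflection_pos a Suc.prems(1) False by metis
    have "b' = (reflection e \<beta>, k - ?m * level e, 0)" by (simp add: b'_def a_def b areflection_root[OF er])
    then have "h * center_value b' = height \<beta> + h * k - ?m * (height e + h * level e)"
      using h_pos by (simp add: center_value_root reflection_coroot' field_simps)
    also have "height e + h * level e = h * center_value a"
      using h_pos by (simp add: a_def center_value_root field_simps)
    also have "h * center_value a = 1"
      using center_value_asimple[OF e(1)] h_pos by (simp add: a_def)
    also have "height \<beta> + h * k = h * center_value b"
      using h_pos by (simp add: b center_value_root field_simps)
    finally have "h * center_value b' \<le> of_nat n" using m Suc.prems(2) by simp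
    then have IH: "areflection b' \<in> affine_weyl" using Suc.IH b' by blast
    have aw: "areflection a \<in> affine_weyl" using affine_weyl_areflection a .
    have "areflection a \<circ> areflection b' = areflection (areflection a b') \<circ> areflection a"
      using areflection_conj aw affine_weyl_subset by blast
    also have "areflection a b' = b" unfolding b'_def using areflection_involution asimple_aroot a by blast
    finally have eq: "areflection a \<circ> areflection b' = areflection b \<circ> areflection a" .
    have "areflection b = areflection a \<circ> areflection b' \<circ> areflection a"
      unfolding eq using areflection_involution[OF asimple_aroot[OF a]] by (intro ext) simp
    then show ?thesis using affine_weyl_comp aw IH by metis
  qed (rule affine_weyl_areflection)
qed

lemma aroot_reflection_affine_weyl: "b \<in> aroots \<Longrightarrow> areflection b \<in> affine_weyl"
proof -
  have pos: "areflection c \<in> affine_weyl" if "c \<in> apos_roots" for c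
    using apos_reflection_affine_weyl[OF that] reals_Archimedean2[of "h * center_value c"]
    by (blast intro: less_imp_le)
  assume "b \<in> aroots"
  then show ?thesis using aroot_pos_or_neg[of b] pos[of b] pos[of "- b"] by (auto simp: areflection_minus)
qed

lemma lift_affine_weyl: "v \<in> weyl \<Longrightarrow> lift v \<in> affine_weyl"
  unfolding weyl_def
proof (induction v rule: refl_group.induct)
  case one
  have "lift id = id" by (rule ext) auto
  then show ?case using affine_weyl_id by (simp only:)
next
  case (step s w)
  then obtain \<alpha> where a: "\<alpha> \<in> \<Delta>" "s = reflection \<alpha>" by blast
  have "translation 0 = id" by (rule ext) auto
  then have "areflection (\<alpha>, 0, 0) = lift s" using areflection_eq[OF a(1), of 0] a(2) by simp
  moreover have "areflection (\<alpha>, 0, 0) \<in> affine_weyl"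
    using a by (intro aroot_reflection_affine_weyl) (auto simp: aroots_def)
  moreover have "lift (s \<circ> w) = lift s \<circ> lift w" by (rule ext) auto
  ultimately show ?case using affine_weyl_comp step.IH by metis
qed

text \<open>The translation is the product of the reflections in \<open>\<beta>\<close> and in
  \<open>\<beta> + k \<delta>\<close>.\<close>

lemma translation_coroot_affine_weyl:
  assumes "\<beta> \<in> \<Delta>" "k \<in> \<int>" shows "translation (k *s coroot \<beta>) \<in> affine_weyl"
proof -
  have "lift (reflection \<beta>) \<circ> lift (reflection \<beta>) = id"
    using reflection_reflection[OF assms(1)] by (intro ext) auto
  then have "translation (k *s coroot \<beta>) = lift (reflection \<beta>) \<circ> areflection (\<beta>, k, 0)"
    unfolding areflection_eq[OF assms(1)] by (simp flip: comp_assoc)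
  moreover have "areflection (\<beta>, k, 0) \<in> affine_weyl"
    using assms by (intro aroot_reflection_affine_weyl) (auto simp: aroots_def)
  ultimately show ?thesis
    using affine_weyl_comp lift_affine_weyl weyl_reflection[OF assms(1)] by metis
qed

lemma translation_affine_weyl:
  assumes "r \<in> coroot_lattice" shows "translation r \<in> affine_weyl"
proof -
  obtain n :: "'v \<Rightarrow> int" where r: "r = (\<Sum>\<alpha>\<in>\<Pi>. of_int (n \<alpha>) *s coroot \<alpha>)"
    using assms by (auto simp: coroot_lattice_def)
  have "translation (\<Sum>\<alpha>\<in>A. of_int (n \<alpha>) *s coroot \<alpha>) \<in> affine_weyl" if "A \<subseteq> \<Pi>" for A
    using finite_subset[OF that finite_Basis] that
  proof (induction A rule: finite_induct)
    case empty
    have "translation 0 = id" by (rule ext) auto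
    then show ?case using affine_weyl_id by (simp only: sum.empty)
  next
    case (insert \<alpha> A)
    then have "translation (of_int (n \<alpha>) *s coroot \<alpha>) \<circ> translation (\<Sum>\<alpha>\<in>A. of_int (n \<alpha>) *s coroot \<alpha>)
        \<in> affine_weyl"
      using simple_root by (intro affine_weyl_comp translation_coroot_affine_weyl) auto
    moreover have "(\<Sum>\<alpha>\<in>insert \<alpha> A. of_int (n \<alpha>) *s coroot \<alpha>)
        = of_int (n \<alpha>) *s coroot \<alpha> + (\<Sum>\<alpha>\<in>A. of_int (n \<alpha>) *s coroot \<alpha>)"
      using insert.hyps by simp
    ultimately show ?case by (simp only: translation_add)
  qed
  then show ?thesis using r by blast
qed

lemma affine_weyl_eq: "affine_weyl = weyl_translations"
  using affine_weyl_subset affine_weyl_comp lift_affine_weyl translation_affine_weyl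
  by (auto simp: weyl_translations_def)

section \<open>Words in the affine simple reflections and freeness at the centre\<close>

definition word :: "('v \<times> rat \<times> rat) list \<Rightarrow> 'v \<times> rat \<times> rat \<Rightarrow> 'v \<times> rat \<times> rat" where
  "word as = foldr (\<lambda>a f. areflection a \<circ> f) as id"

lemma word_simps [simp]: "word [] = id" "word (a # as) = areflection a \<circ> word as"
  by (simp_all add: word_def)

lemma word_append: "word (as @ bs) = word as \<circ> word bs"
  by (induction as) (simp_all add: comp_assoc)

lemma word_affine_weyl: "set as \<subseteq> asimple_roots \<Longrightarrow> word as \<in> affine_weyl"
proof (induction as)
  case Nil
  then show ?case using affine_weyl_id by (simp only: word_simps)
next
  case (Cons a as)
  then have "areflection a \<circ> word as \<in> affine_weyl"
    by (intro affine_weyl_comp affine_weyl_areflection) auto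
  then show ?case by (simp only: word_simps)
qed

lemma affine_weyl_word: "w \<in> affine_weyl \<Longrightarrow> \<exists>as. set as \<subseteq> asimple_roots \<and> w = word as"
  unfolding affine_weyl_def
proof (induction w rule: refl_group.induct)
  case one
  then show ?case by (intro exI[of _ "[]"]) simp
next
  case (step s w)
  then obtain a as where "a \<in> asimple_roots" "s = areflection a" "set as \<subseteq> asimple_roots" "w = word as"
    by blast
  then show ?case by (intro exI[of _ "a # as"]) simp
qed

text \<open>Letters act from the right; the letter \<open>c\<close> is one at which the image leaves
  the positive roots.\<close>

lemma word_sign_change:
  "b \<in> apos_roots \<Longrightarrow> word as b \<notin> apos_roots \<Longrightarrow>
    \<exists>as1 c as2. as = as1 @ c # as2 \<and> word as2 b \<in> apos_roots \<and> areflection c (word as2 b) \<notin> apos_roots"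
proof (induction as)
  case (Cons a as)
  show ?case
  proof (cases "word as b \<in> apos_roots")
    case True
    then show ?thesis using Cons.prems by (intro exI[of _ "[]"] exI[of _ a] exI[of _ as]) simp
  next
    case False
    then obtain as1 c as2 where "as = as1 @ c # as2" "word as2 b \<in> apos_roots"
      "areflection c (word as2 b) \<notin> apos_roots" using Cons by blast
    then show ?thesis by (intro exI[of _ "a # as1"] exI[of _ c] exI[of _ as2]) simp
  qed
qed simp

text \<open>Exchange condition: if the last letter is not sent to a negative root, it cancels against
  an earlier one.\<close>

lemma word_preserving_pos_eq_id:
  assumes "set as \<subseteq> asimple_roots" "\<And>a. a \<in> asimple_roots \<Longrightarrow> word as a \<in> apos_roots"
  shows "word as = id"
  using assms
proof (induction "length as" arbitrary: as rule: less_induct)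
  case less
  show ?case
  proof (cases as rule: rev_cases)
    case (snoc bs a)
    then have a: "a \<in> asimple_roots" and bs: "set bs \<subseteq> asimple_roots" using less.prems by auto
    \<comment> \<open>The last letter turns \<open>a\<close> into \<open>- a\<close>, so the
      shortened word must make \<open>a\<close> negative.\<close>
    have "word as a = word bs (- a)" using snoc a by (simp add: word_append areflection_self asimple_aroot)
    also have "\<dots> = - word bs a"
      using word_affine_weyl[OF bs] affine_weyl_subset weyl_translations_minus by blast
    finally have "- word bs a \<in> apos_roots" using less.prems(2)[OF a] by simp
    then have "word bs a \<notin> apos_roots" by (simp add: apos_roots_iff)
    then obtain as1 c as2 where bs_eq: "bs = as1 @ c # as2" and p: "word as2 a \<in> apos_roots"
      and n: "areflection c (word as2 a) \<notin> apos_roots"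
      using word_sign_change asimple_apos[OF a] by blast
    have "c \<in> asimple_roots" using bs bs_eq by simp
    \<comment> \<open>The only positive root that the reflection in \<open>c\<close> makes negative
      is \<open>c\<close> itself.\<close>
    then have c: "word as2 a = c" using asimple_reflection_pos p n by blast
    have "word as2 \<in> weyl_translations"
      using word_affine_weyl[of as2] bs bs_eq affine_weyl_subset by auto
    then have "areflection c \<circ> word as2 = word as2 \<circ> areflection a" using areflection_conj c by metis
    \<comment> \<open>The letters \<open>c\<close> and \<open>a\<close> cancel, leaving a word
      shorter by two with the same action.\<close>
    then have "areflection c (word as2 (areflection a x)) = word as2 x" for x
      using areflection_involution[OF asimple_aroot[OF a]] by (metis comp_apply)
    then have eq: "word as = word (as1 @ as2)"
      by (intro ext) (simp add: snoc bs_eq word_append)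
    have "word (as1 @ as2) = id"
      using less.hyps[of "as1 @ as2"] less.prems bs bs_eq snoc unfolding eq by simp
    then show ?thesis using eq by simp
  qed simp
qed

text \<open>Pairing an affine root with \<open>(center, c, 1)\<close> gives its value at the centre
  whatever \<open>c\<close> is. As the form is preserved, so are these values, and with them
  positivity.\<close>

lemma affine_weyl_free:
  assumes w: "w \<in> affine_weyl" and fix_center: "w (center, 0, 1) = (center, c, 1)"
  shows "w = id"
proof -
  have wt: "w \<in> weyl_translations" using w affine_weyl_subset by blast
  have "w a \<in> apos_roots" if a: "a \<in> asimple_roots" for a
  proof -
    have r: "w a \<in> aroots" using weyl_translations_aroot[OF wt asimple_aroot[OF a]] .
    then obtain \<beta> k where b: "w a = (\<beta>, k, 0)" by (auto simp: aroots_def)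
    have "center_value (w a) = aip (w a) (w (center, 0, 1))"
      by (simp add: fix_center b center_value_def)
    also have "\<dots> = center_value a" by (simp add: weyl_translations_linear[OF wt] center_value_def)
    finally show ?thesis using r asimple_apos[OF a] by (simp add: apos_roots_iff)
  qed
  then show ?thesis using affine_weyl_word[OF w] word_preserving_pos_eq_id by blast
qed

subsection \<open>The integral vertex\<close>

text \<open>All simple roots take the value \<open>1 + 1 / h\<close> here.\<close>

definition outer_center :: 'v where
  "outer_center = rho + center"

lemma outer_center_eq: "outer_center = ((h + 1) / h) *s rho"
  using h_pos scale_left_distrib[of 1 "1 / h" rho]
  by (simp add: outer_center_def center_def add_divide_distrib)

text \<open>These are the values at the centre of the affine root
  \<open>(\<beta>, - ip \<tau> \<beta>, 0)\<close>.\<close>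

lemma center_minus_lattice_value:
  assumes "\<tau> \<in> coroot_lattice" "\<beta> \<in> \<Delta>"
  shows "h * ip (center - \<tau>) \<beta> \<in> \<int>" "ip (center - \<tau>) \<beta> \<noteq> 0"
proof -
  have "(\<beta>, - ip \<tau> \<beta>, 0) \<in> aroots"
    using assms coroot_lattice_ip_int by (auto simp: aroots_def)
  from aroot_center_value[OF this]
  show "h * ip (center - \<tau>) \<beta> \<in> \<int>" "ip (center - \<tau>) \<beta> \<noteq> 0"
    by (simp_all add: center_value_root ip_diff ip_center)
qed

lemma weyl_span_image:
  assumes u: "u \<in> weyl" and E: "finite E" "span E = UNIV" shows "span (u ` E) = UNIV"
proof -
  obtain u' where u': "u' \<in> weyl" "\<And>x. u' (u x) = x" "\<And>x. u (u' x) = x"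
    using weyl_inverse[OF u] by blast
  have "x \<in> span (u ` E)" for x
  proof -
    have "u' x \<in> span E" using E by simp
    then obtain t where t: "u' x = (\<Sum>e\<in>E. t e *s e)" using span_finite[OF E(1)] by auto
    have "x = u (u' x)" by (simp only: u'(3))
    also have "\<dots> = (\<Sum>e\<in>E. t e *s u e)" by (simp add: t weyl_sum[OF u] weyl_linear[OF u])
    also have "\<dots> \<in> span (u ` E)" by (intro span_sum span_scale span_base imageI)
    finally show ?thesis .
  qed
  then show ?thesis by blast
qed

text \<open>Descent within the finite Weyl orbit reaches a dominant vector; rescaled, it meets the
  hypotheses of \<open>dominant_regular_eq_rho\<close> with the images of the facet normals as
  \<open>\<Gamma>\<close>.\<close>

lemma integral_vertex_conjugate:
  assumes "vertex \<tau> simplex_D" and \<tau>: "\<tau> \<in> coroot_lattice"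
  obtains u where "u \<in> weyl" "u (center - \<tau>) = outer_center"
proof -
  obtain g where g: "g \<in> ext_simple"
    and facets: "\<And>e. e \<in> ext_simple - {g} \<Longrightarrow> ip \<tau> e + 1 + level e = 0"
    using vertex_facets[OF assms(1)] by blast
  obtain M where M: "M > 0" "\<And>\<beta>. \<beta> \<in> \<Delta> \<Longrightarrow> ip \<beta> \<beta> \<le> M" using root_norm_bound by blast
  let ?P = "\<lambda>z. \<exists>u\<in>weyl. u (center - \<tau>) = z"
  \<comment> \<open>Moving the Weyl element onto the root reduces the values of \<open>z\<close> to
    those of \<open>center - \<tau>\<close>.\<close>
  have val: "h * ip z \<beta> \<in> \<int>" "ip z \<beta> \<noteq> 0" if z: "?P z" and b: "\<beta> \<in> \<Delta>" for z \<beta>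
  proof -
    obtain u where u: "u \<in> weyl" "u (center - \<tau>) = z" using z by blast
    obtain u' where u': "u' \<in> weyl" "\<And>x. u' (u x) = x" "\<And>x. u (u' x) = x"
      using weyl_inverse[OF u(1)] by blast
    have "ip z \<beta> = ip (u' z) (u' \<beta>)" using weyl_ip[OF u'(1)] by simp
    also have "u' z = center - \<tau>" using u' u by blast
    finally show "h * ip z \<beta> \<in> \<int>" "ip z \<beta> \<noteq> 0"
      using center_minus_lattice_value[OF \<tau> weyl_root[OF u'(1) b]] by simp_all
  qed
  obtain z where z: "?P z" "\<And>e k. (e, k) \<in> \<Pi> \<times> {0} \<Longrightarrow> ip z e + k \<ge> 0"
  \<comment> \<open>Negative values are at most \<open>- 1 / h\<close> and the centre has value
    \<open>1 / h\<close>; with root norms at most \<open>M\<close> this gives the decrease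
    \<open>1 / (h * h * M)\<close>.\<close>
  proof (rule descent[where P = ?P and ?z0.0 = "center - \<tau>" and c = center
        and \<epsilon> = "1 / (h * h * M)" and S = "\<Pi> \<times> {0}"])
    show "?P (center - \<tau>)" using weyl_id by (intro bexI[of _ id]) simp_all
    show "1 / (h * h * M) > 0" using h_pos M by simp
    show "\<Pi> \<times> {0::rat} \<subseteq> \<Delta> \<times> UNIV" using simple_root by blast
    fix z e and k :: rat assume as: "?P z" "(e, k) \<in> \<Pi> \<times> {0}" "ip z e + k < 0"
    then have e: "e \<in> \<Pi>" "e \<in> \<Delta>" and k: "k = 0" using simple_root by auto
    obtain u where u: "u \<in> weyl" "u (center - \<tau>) = z" using as(1) by blast
    have "?P (reflection e z)"
      using weyl_comp[OF weyl_reflection[OF e(2)] u(1)] u(2)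
      by (intro bexI[of _ "reflection e \<circ> u"]) simp_all
    moreover have "h * ip z e < 0" using as(3) k h_pos by (simp add: mult_pos_neg)
    then have "h * ip z e \<le> -1" using val(1)[OF as(1) e(2)] by (auto elim!: Ints_cases)
    then have "h * ip z e * M \<le> (-1) * M" using M by (intro mult_right_mono) auto
    then have "h * ip z e * M \<le> - ip e e" using M(2)[OF e(2)] by linarith
    then have "ip z e * (1 / h) \<le> - (1 / (h * h * M)) * ip e e"
      using h_pos M(1) by (simp add: field_simps)
    moreover have "ip center e = 1 / h" using e(1) by (simp add: ip_center height_simple)
    ultimately show "?P (z - (ip z e + k) *s coroot e) \<and>
        (ip z e + k) * (ip center e + k) \<le> - (1 / (h * h * M)) * ip e e"
      by (simp add: k reflection_coroot)
  next
    fix z assume "?P z" "\<And>e k. (e, k) \<in> \<Pi> \<times> {0} \<Longrightarrow> ip z e + k \<ge> 0"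
    then show thesis using that by blast
  qed
  obtain u where u: "u \<in> weyl" "u (center - \<tau>) = z" using z(1) by blast
  \<comment> \<open>The facet normals give \<open>z\<close> the value \<open>(h + 1) / h\<close>;
    the scaling makes it 1.\<close>
  define q where "q = (h / (h + 1)) *s z"
  have "q = rho"
  proof (rule dominant_regular_eq_rho[of q "u ` (ext_simple - {g})"])
    fix \<alpha> assume a: "\<alpha> \<in> \<Pi>"
    have "ip z \<alpha> \<ge> 0" using z(2)[of \<alpha> 0] a by simp
    then have "ip z \<alpha> > 0" using val(2)[OF z(1) simple_root[OF a]] by simp
    then show "ip q \<alpha> > 0" using h_pos by (simp add: q_def ip_scale)
  next
    show "u ` (ext_simple - {g}) \<subseteq> \<Delta>" using weyl_root[OF u(1)] ext_simple_root by blast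
    show "span (u ` (ext_simple - {g})) = UNIV"
      using weyl_span_image[OF u(1)] span_ext_simple_remove[OF g] by simp
  next
    fix \<gamma> assume "\<gamma> \<in> u ` (ext_simple - {g})"
    then obtain e where e: "e \<in> ext_simple - {g}" "\<gamma> = u e" by blast
    have "ip z \<gamma> = ip (center - \<tau>) e" using weyl_ip[OF u(1)] u(2) e(2) by blast
    \<comment> \<open>The facet equation at \<open>\<tau>\<close> is subtracted from the value
      \<open>1 / h\<close> at the centre, and the levels cancel.\<close>
    also have "\<dots> = 1 / h + 1"
      using ext_simple_center[of e] facets[OF e(1)] e(1) by (simp add: ip_diff)
    finally show "ip q \<gamma> = 1" using h_pos by (simp add: q_def ip_scale field_simps)
  qed
  then have "((h + 1) / h) *s ((h / (h + 1)) *s z) = outer_center"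
    unfolding q_def outer_center_eq by simp
  then have "z = outer_center" using h_pos by simp
  then show ?thesis using that u by blast
qed

text \<open>Both vertices give affine Weyl elements carrying the centre to
  \<open>outer_center\<close> up to \<delta>; freeness makes these equal, and their translation
  parts can be compared.\<close>

lemma integral_vertex_unique:
  assumes "vertex \<tau> simplex_D" "\<tau> \<in> coroot_lattice" "vertex \<tau>' simplex_D" "\<tau>' \<in> coroot_lattice"
  shows "\<tau> = \<tau>'"
proof -
  obtain u where u: "u \<in> weyl" "u (center - \<tau>) = outer_center"
    using integral_vertex_conjugate assms by blast
  obtain u' where u': "u' \<in> weyl" "u' (center - \<tau>') = outer_center"
    using integral_vertex_conjugate assms by blast
  define f where "f = lift u \<circ> translation (- \<tau>)"
  define f' where "f' = lift u' \<circ> translation (- \<tau>')"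
  have f: "f \<in> affine_weyl" "f' \<in> affine_weyl"
    unfolding affine_weyl_eq f_def f'_def weyl_translations_def
    using u u' coroot_lattice_minus assms by blast+
  obtain a where a: "f (center, 0, 1) = (outer_center, a, 1)" using u by (simp add: f_def)
  obtain a' where a': "f' (center, 0, 1) = (outer_center, a', 1)" using u' by (simp add: f'_def)
  obtain k where k: "k \<in> affine_weyl" "\<And>x. k (f' x) = x" "\<And>x. f' (k x) = x"
    using affine_weyl_inverse[OF f(2)] by blast
  have kw: "k \<in> weyl_translations" using k(1) affine_weyl_subset by blast
  have k_delta: "k (0, c, 0) = (0, c, 0)" for c
  proof -
    obtain v r where "k = lift v \<circ> translation r" "v \<in> weyl" using kw by (auto simp: weyl_translations_def)
    then show ?thesis by (simp add: weyl_zero)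
  qed
  \<comment> \<open>The two images differ by a multiple of \<delta>, which every affine Weyl element
    fixes.\<close>
  have "k (f (center, 0, 1)) = k (f' (center, 0, 1) + (0, a - a', 0))" by (simp add: a a')
  also have "\<dots> = (center, a - a', 1)"
    by (simp only: weyl_translations_linear[OF kw] k(2) k_delta) simp
  finally have "(k \<circ> f) (center, 0, 1) = (center, a - a', 1)" by simp
  then have "k \<circ> f = id" using affine_weyl_free affine_weyl_comp k(1) f(1) by blast
  then have eq: "f x = f' x" for x by (metis comp_apply id_apply k(3))
  \<comment> \<open>The finite part identifies \<open>u\<close> with \<open>u'\<close>; the
    \<lambda>-direction then compares the translations.\<close>
  have "u x = u' x" for x using eq[of "(x, 0, 0)"] by (simp add: f_def f'_def)
  then have "u (- \<tau>) = u (- \<tau>')" using eq[of "(0, 0, 1)"] by (simp add: f_def f'_def)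
  moreover obtain v where "v \<in> weyl" "\<And>x. v (u x) = x" "\<And>x. u (v x) = x"
    using weyl_inverse[OF u(1)] by blast
  ultimately have "- \<tau> = - \<tau>'" by metis
  then show ?thesis by simp
qed

section \<open>The affine orbit of the centre and the ideal of all positive roots\<close>

lemma aip_outer_center: "aip (\<beta>, k, 0) (outer_center, 0, 1) = height \<beta> + height \<beta> / h + k"
  by (simp add: outer_center_def ip_linear ip_sym[of \<beta> rho] ip_sym[of \<beta> center] ip_rho ip_center)

text \<open>Shifting \<open>k\<close> by the integer \<open>height \<beta>\<close> turns a value at
  \<open>outer_center\<close> into a value at the centre.\<close>

lemma aroot_outer_center:
  assumes "b \<in> aroots"
  shows "h * aip b (outer_center, 0, 1) \<in> \<int>" "aip b (outer_center, 0, 1) \<noteq> 0"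
proof -
  obtain \<beta> k where b: "b = (\<beta>, k, 0)" "\<beta> \<in> \<Delta>" "k \<in> \<int>" using assms by (auto simp: aroots_def)
  then have "(\<beta>, k + height \<beta>, 0) \<in> aroots" using height_root_int by (auto simp: aroots_def)
  moreover have "aip b (outer_center, 0, 1) = center_value (\<beta>, k + height \<beta>, 0)"
    unfolding b aip_outer_center by (simp add: center_value_root)
  ultimately show "h * aip b (outer_center, 0, 1) \<in> \<int>" "aip b (outer_center, 0, 1) \<noteq> 0"
    using aroot_center_value by metis+
qed

text \<open>Descent through affine simple reflections ends where all affine simple roots are at
  least \<open>1 / h\<close>. Their marked sum is 1 and the marks add up to \<open>h\<close>, so all
  values equal \<open>1 / h\<close> and the end point is the centre.\<close>

lemma outer_center_conjugate:
  obtains w c where "w \<in> affine_weyl" "w (outer_center, 0, 1) = (center, c, 1)"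
proof -
  obtain M where M: "M > 0" "\<And>\<beta>. \<beta> \<in> \<Delta> \<Longrightarrow> ip \<beta> \<beta> \<le> M" using root_norm_bound by blast
  let ?P = "\<lambda>z. \<exists>w\<in>affine_weyl. \<exists>c. w (outer_center, 0, 1) = (z, c, 1)"
  let ?S = "(\<lambda>e. (e, level e)) ` ext_simple"
  \<comment> \<open>Pulled back by the inverse, these are values of affine roots at
    \<open>outer_center\<close>.\<close>
  have val: "h * (ip z e + level e) \<in> \<int>" "ip z e + level e \<noteq> 0"
    if z: "?P z" and e: "e \<in> ext_simple" for z e
  proof -
    obtain w c where w: "w \<in> affine_weyl" "w (outer_center, 0, 1) = (z, c, 1)" using z by blast
    obtain u where u: "u \<in> affine_weyl" "\<And>x. u (w x) = x" "\<And>x. w (u x) = x"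
      using affine_weyl_inverse[OF w(1)] by blast
    have ut: "u \<in> weyl_translations" using u affine_weyl_subset by blast
    have a: "(e, level e, 0) \<in> aroots" using e level_int ext_simple_root by (auto simp: aroots_def)
    have "ip z e + level e = aip (e, level e, 0) (w (outer_center, 0, 1))"
      by (simp add: w(2) ip_sym[of e z])
    also have "\<dots> = aip (u (e, level e, 0)) (u (w (outer_center, 0, 1)))"
      by (simp only: weyl_translations_linear[OF ut])
    also have "\<dots> = aip (u (e, level e, 0)) (outer_center, 0, 1)" by (simp only: u(2))
    finally show "h * (ip z e + level e) \<in> \<int>" "ip z e + level e \<noteq> 0"
      using aroot_outer_center[OF weyl_translations_aroot[OF ut a]] by simp_all
  qed
  obtain z where z: "?P z" "\<And>e k. (e, k) \<in> ?S \<Longrightarrow> ip z e + k \<ge> 0"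
  proof (rule descent[where P = ?P and ?z0.0 = outer_center and c = center
        and \<epsilon> = "1 / (h * h * M)" and S = ?S])
    show "?P outer_center" using affine_weyl_id by (intro bexI[of _ id] exI[of _ 0]) simp_all
    show "1 / (h * h * M) > 0" using h_pos M by simp
    show "?S \<subseteq> \<Delta> \<times> UNIV" using ext_simple_root by blast
    fix z e and k :: rat assume as: "?P z" "(e, k) \<in> ?S" "ip z e + k < 0"
    then have e: "e \<in> ext_simple" "e \<in> \<Delta>" and k: "k = level e" using ext_simple_root by auto
    obtain w c where w: "w \<in> affine_weyl" "w (outer_center, 0, 1) = (z, c, 1)" using as(1) by blast
    have "areflection (e, k, 0) \<in> affine_weyl"
      using e k by (intro affine_weyl_areflection) (simp add: asimple_roots_eq)
    then have "areflection (e, k, 0) \<circ> w \<in> affine_weyl" using w(1) by (rule affine_weyl_comp)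
    moreover have "\<exists>c'. (areflection (e, k, 0) \<circ> w) (outer_center, 0, 1)
        = (z - (ip z e + k) *s coroot e, c', 1)"
      by (simp add: w(2) areflection_def coroot_def mult.commute)
    ultimately have "?P (z - (ip z e + k) *s coroot e)" by blast
    moreover have "h * (ip z e + k) < 0" using as(3) h_pos by (simp add: mult_pos_neg)
    then have "h * (ip z e + k) \<le> -1" using val(1)[OF as(1) e(1)] k by (auto elim!: Ints_cases)
    then have "h * (ip z e + k) * M \<le> (-1) * M" using M by (intro mult_right_mono) auto
    then have "h * (ip z e + k) * M \<le> - ip e e" using M(2)[OF e(2)] by linarith
    then have "h * (ip z e + k) * M / (h * h * M) \<le> - ip e e / (h * h * M)"
      using h_pos M(1) by (intro divide_right_mono) auto
    then have "(ip z e + k) * (1 / h) \<le> - (1 / (h * h * M)) * ip e e"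
      using h_pos M(1) by simp
    ultimately show "?P (z - (ip z e + k) *s coroot e) \<and>
        (ip z e + k) * (ip center e + k) \<le> - (1 / (h * h * M)) * ip e e"
      using ext_simple_center[OF e(1)] k by simp
  next
    fix z assume "?P z" "\<And>e k. (e, k) \<in> ?S \<Longrightarrow> ip z e + k \<ge> 0"
    then show thesis using \<open>\<And>z. \<lbrakk>?P z; \<And>e k. (e, k) \<in> ?S \<Longrightarrow> ip z e + k \<ge> 0\<rbrakk> \<Longrightarrow> thesis\<close> by blast
  qed
  let ?d = "\<lambda>e. ip z e + level e - 1 / h"
  have d_nonneg: "?d e \<ge> 0" if e: "e \<in> ext_simple" for e
  proof -
    have "ip z e + level e > 0" using z(2)[of e "level e"] val(2)[OF z(1) e] e by fastforce
    then have "h * (ip z e + level e) > 0" using h_pos by simp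
    then have "h * (ip z e + level e) \<ge> 1" using val(1)[OF z(1) e] by (auto elim!: Ints_cases)
    then show ?thesis using h_pos by (simp add: field_simps)
  qed
  have "(\<Sum>e\<in>ext_simple. mark e * ?d e) = 0"
  proof -
    have "(\<Sum>e\<in>ext_simple. mark e * ?d e) = (\<Sum>e\<in>ext_simple. mark e * ip z e)
        + (\<Sum>e\<in>ext_simple. mark e * level e) - (\<Sum>e\<in>ext_simple. mark e) * (1 / h)"
      by (simp add: sum.distrib sum_subtractf sum_divide_distrib distrib_left right_diff_distrib)
    then show ?thesis using h_pos by (simp add: sum_mark_ip sum_mark_level sum_mark)
  qed
  moreover have "mark e * ?d e \<ge> 0" if "e \<in> ext_simple" for e
    using d_nonneg[OF that] mark_ge_1[OF that] by simp
  ultimately have zero: "\<forall>e\<in>ext_simple. mark e * ?d e = 0"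
    using sum_nonneg_eq_0_iff[OF finite_ext_simple, of "\<lambda>e. mark e * ?d e"] by blast
  have "z - center = 0"
  proof (rule ip_nondegenerate)
    fix \<alpha> assume "\<alpha> \<in> \<Pi>"
    then have a: "\<alpha> \<in> ext_simple" by (simp add: ext_simple_def)
    then have "?d \<alpha> = 0" using zero mark_ge_1[OF a] by fastforce
    then show "ip (z - center) \<alpha> = 0" using ext_simple_center[OF a] by (simp add: ip_diff)
  qed
  then show ?thesis using z(1) that by auto
qed

lemma inv_affine_weyl:
  assumes "\<And>x. u (w x) = x" "\<And>x. w (u x) = x" shows "inv w = u"
  using assms by (intro inv_equality)

text \<open>For \<open>w\<close> carrying \<open>outer_center\<close> to the centre, the sign of
  \<open>w b\<close> is that of \<open>b\<close> at \<open>outer_center\<close>, where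
  \<open>\<beta> + k \<delta>\<close> has value \<open>height \<beta> * (1 + 1 / h) + k\<close>.
  Simple roots come out positive and \<open>\<delta> - \<gamma>\<close> negative.\<close>

lemma admissible_pos_roots_exists: "\<exists>w. admissible w \<and> ideal_of w = pos_roots"
proof -
  obtain w c where w: "w \<in> affine_weyl" "w (outer_center, 0, 1) = (center, c, 1)"
    using outer_center_conjugate by blast
  have wt: "w \<in> weyl_translations" using w(1) affine_weyl_subset by blast
  obtain u where u: "u \<in> affine_weyl" "\<And>x. u (w x) = x" "\<And>x. w (u x) = x"
    using affine_weyl_inverse[OF w(1)] by blast
  have ut: "u \<in> weyl_translations" using u affine_weyl_subset by blast
  have cv: "center_value (w b) = aip b (outer_center, 0, 1)" if b: "b \<in> aroots" for b
  proof -
    obtain \<beta> k where "w b = (\<beta>, k, 0)" using weyl_translations_aroot[OF wt b] by (auto simp: aroots_def)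
    then have "center_value (w b) = aip (w b) (w (outer_center, 0, 1))"
      by (simp add: w(2) center_value_def)
    then show ?thesis by (simp only: weyl_translations_linear[OF wt])
  qed
  have "w (emb \<alpha>) \<in> apos_roots" if a: "\<alpha> \<in> \<Pi>" for \<alpha>
  proof -
    have b: "(\<alpha>, 0, 0) \<in> aroots" using simple_root[OF a] by (simp add: aroots_def)
    have "center_value (w (\<alpha>, 0, 0)) > 0"
      using h_pos a unfolding cv[OF b] aip_outer_center by (simp add: height_simple add_pos_pos)
    then show ?thesis using weyl_translations_aroot[OF wt b] by (simp add: apos_roots_iff emb_def)
  qed
  moreover have "\<exists>\<gamma>\<in>pos_roots. inv w a = emb \<gamma> - delta"
    if a: "a \<in> asimple_roots" and neg: "inv w a \<in> uminus ` apos_roots" for a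
  proof -
    have inv: "inv w a = u a" using inv_affine_weyl[of u w] u by simp
    have ua: "u a \<in> aroots" using weyl_translations_aroot[OF ut asimple_aroot[OF a]] .
    then obtain \<beta> k where b: "u a = (\<beta>, k, 0)" "\<beta> \<in> \<Delta>" "k \<in> \<int>" by (auto simp: aroots_def)
    \<comment> \<open>Value \<open>1 / h\<close> at \<open>outer_center\<close> becomes
      \<open>n * N + n + K * N = 1\<close>; given \<open>n < N\<close> and that the root is
      negative, only \<open>n = 1\<close> and \<open>K = -1\<close> remain.\<close>
    obtain n K N :: int where ints: "height \<beta> = of_int n" "k = of_int K" "h = of_int N"
      using height_root_int[OF b(2)] b(3) coxeter_number_int by (auto elim!: Ints_cases)
    have "aip (u a) (outer_center, 0, 1) = 1 / h"
      using cv[OF ua] u(3)[of a] a center_value_asimple by (auto simp: asimple_roots_eq)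
    then have "height \<beta> + height \<beta> / h + k = 1 / h" unfolding b aip_outer_center .
    then have "height \<beta> * h + height \<beta> + k * h = 1" using h_pos by (simp add: field_simps)
    then have "of_int (n * N + n + K * N) = (of_int 1 :: rat)" by (simp add: ints)
    then have eq: "n * N + n + K * N = 1" unfolding of_int_eq_iff .
    have "of_int 2 \<le> (of_int N :: rat)" using coxeter_number_ge_2 ints by simp
    then have N: "N \<ge> 2" unfolding of_int_le_iff .
    have "of_int n \<le> (of_int (N - 1) :: rat)" using height_le_highest[OF b(2)] ints by simp
    then have nN: "n \<le> N - 1" unfolding of_int_le_iff .
    have "- u a \<in> apos_roots" using neg inv by auto
    then have "center_value (- \<beta>, - k, 0) > 0" by (simp add: b apos_roots_iff)
    then have "- k \<ge> 1 \<or> (- k = 0 \<and> - \<beta> \<in> pos_roots)"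
      using center_value_pos_iff[of "- \<beta>" "- k"] root_minus b by simp
    then have "n = 1 \<and> K = -1"
    proof
      assume "- k \<ge> 1"
      then have K: "K \<le> -1" using ints by linarith
      then have "K * N \<le> (-1) * N" using N by (intro mult_right_mono) auto
      then have ge: "n * (N + 1) \<ge> 1 + N" using eq by (simp add: algebra_simps)
      have n1: "n \<ge> 1"
      proof (rule ccontr)
        assume "\<not> ?thesis"
        then have "n * (N + 1) \<le> 0" using N by (intro mult_nonpos_nonneg) auto
        then show False using ge N by linarith
      qed
      \<comment> \<open>Since \<open>1 - n\<close> lies between \<open>2 - N\<close> and 0, the
        factor \<open>n + K\<close> must be 0.\<close>
      have eq2: "N * (n + K) = 1 - n" using eq by (simp add: algebra_simps)
      have "N * (n + K) > N * (-1)" using eq2 nN by simp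
      then have "n + K > -1" using N by (simp only: mult_less_cancel_left)
      moreover have "n + K \<le> 0"
      proof (rule ccontr)
        assume "\<not> ?thesis"
        then have "N * (n + K) > 0" using N by simp
        then show False using eq2 n1 by simp
      qed
      ultimately have "n + K = 0" by simp
      then show ?thesis using eq2 by simp
    next
      assume "- k = 0 \<and> - \<beta> \<in> pos_roots"
      then have "K = 0" "n \<le> -1" using height_pos_root[of "- \<beta>"] ints by simp_all
      then have "n * N \<le> (-1) * N" using N by (intro mult_right_mono) auto
      then show ?thesis using eq \<open>K = 0\<close> \<open>n \<le> -1\<close> N by simp
    qed
    then have "\<beta> \<in> pos_roots" "k = -1" using pos_root_iff_height[OF b(2)] ints by simp_all
    then show ?thesis using inv b by (intro bexI[of _ \<beta>]) (simp_all add: emb_def delta_def)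
  qed
  moreover have "ideal_of w = pos_roots"
  proof -
    have "w (delta - emb \<gamma>) \<in> uminus ` apos_roots" if g: "\<gamma> \<in> pos_roots" for \<gamma>
    proof -
      have b: "(- \<gamma>, 1, 0) \<in> aroots" using root_minus[OF pos_root[OF g]] by (simp add: aroots_def)
      have "height \<gamma> / h > 0" using height_pos_root[OF g] h_pos by simp
      then have "center_value (w (- \<gamma>, 1, 0)) < 0"
        using height_pos_root[OF g] unfolding cv[OF b] aip_outer_center by simp
      then show ?thesis
        using weyl_translations_aroot[OF wt b] by (simp add: uminus_apos_roots_iff emb_def delta_def)
    qed
    then show ?thesis by (auto simp: ideal_of_def)
  qed
  ultimately show ?thesis using w(1) unfolding admissible_def by blast
qed

text \<open>Preimages of affine simple roots show that \<open>w\<close> sends each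
  \<open>\<alpha> - \<delta>\<close> with \<open>\<alpha>\<close> simple to an affine simple root.
  The finite parts fill all but one of \<open>ext_simple\<close>, and the \<delta>-coefficients give
  the facet equations at \<open>v r\<close>.\<close>

lemma admissible_pos_roots_vertex:
  assumes adm: "admissible w" and ideal: "ideal_of w = pos_roots"
    and v: "v \<in> weyl" and r: "r \<in> coroot_lattice" and w: "w = lift v \<circ> translation r"
  shows "vertex (v r) simplex_D"
proof -
  have wa: "w \<in> affine_weyl" using adm by (simp add: admissible_def)
  have wt: "w \<in> weyl_translations" using wa affine_weyl_subset by blast
  obtain u where u: "u \<in> affine_weyl" "\<And>x. u (w x) = x" "\<And>x. w (u x) = x"
    using affine_weyl_inverse[OF wa] by blast
  have ut: "u \<in> weyl_translations" using u affine_weyl_subset by blast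
  obtain v' where v': "v' \<in> weyl" "\<And>x. v' (v x) = x" "\<And>x. v (v' x) = x"
    using weyl_inverse[OF v] by blast
  have w_apply: "w (x, k, 0) = (v x, k - ip x r, 0)" for x k by (simp add: w)
  have h1: "1 / h < 1" using coxeter_number_ge_2 by simp
  \<comment> \<open>The ideal contains every positive \<open>\<gamma>\<close>, so \<open>w\<close>
    makes \<open>\<gamma> - \<delta>\<close> positive; hence the image of \<open>\<gamma>\<close>
    itself exceeds 1 at the centre.\<close>
  have shifted: "center_value (w (\<gamma>, -1, 0)) > 0" if "\<gamma> \<in> pos_roots" for \<gamma>
  proof -
    have "w (delta - emb \<gamma>) \<in> uminus ` apos_roots" using that ideal by (auto simp: ideal_of_def)
    moreover have "delta - emb \<gamma> = - (\<gamma>, -1, 0)" by (simp add: delta_def emb_def)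
    then have "w (delta - emb \<gamma>) = - w (\<gamma>, -1, 0)" by (simp only: weyl_translations_minus[OF wt])
    ultimately show ?thesis by (simp add: uminus_apos_roots_iff)
  qed
  have center_w: "center_value (w (\<gamma>, k, 0)) = center_value (w (\<gamma>, -1, 0)) + 1 + k" for \<gamma> k
    by (simp add: w_apply center_value_root)
  \<comment> \<open>An affine simple root has value \<open>1 / h\<close> at the centre, too small
    for the image of \<open>\<gamma> + k \<delta>\<close> with \<open>\<gamma>\<close> positive and
    \<open>k \<ge> 0\<close>, or of \<open>\<gamma> - \<delta>\<close> with \<open>\<gamma>\<close>
    positive but not simple.\<close>
  have simple_or_neg: "v' e \<in> \<Pi> \<and> u (e, level e, 0) = (v' e, -1, 0) \<or> - v' e \<in> pos_roots"
    if e: "e \<in> ext_simple" for e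
  proof -
    let ?a = "(e, level e, 0)"
    have a: "?a \<in> asimple_roots" using e by (simp add: asimple_roots_eq)
    have ua: "u ?a \<in> aroots" using weyl_translations_aroot[OF ut asimple_aroot[OF a]] .
    then obtain \<beta> k where b: "u ?a = (\<beta>, k, 0)" "\<beta> \<in> \<Delta>" "k \<in> \<int>" by (auto simp: aroots_def)
    have wb: "w (\<beta>, k, 0) = ?a" using u(3)[of ?a] b by simp
    then have "v \<beta> = e" by (simp add: w_apply)
    then have ve: "v' e = \<beta>" using v' by blast
    have cw: "center_value (w (\<beta>, k, 0)) = 1 / h" using wb center_value_asimple[OF e] by simp
    show ?thesis
    proof (cases "u ?a \<in> apos_roots")
      case True
      then have "k \<ge> 0" using center_value_pos_iff[OF b(2,3)] by (auto simp: b apos_roots_iff)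
      have "\<beta> \<notin> pos_roots"
      proof
        assume "\<beta> \<in> pos_roots"
        then show False using shifted[of \<beta>] cw \<open>k \<ge> 0\<close> h1 unfolding center_w[of \<beta> k] by simp
      qed
      then show ?thesis using root_pos_or_neg[OF b(2)] ve by simp
    next
      case False
      then have "u ?a \<in> uminus ` apos_roots"
        using aroot_pos_or_neg[OF ua] by (metis image_eqI minus_minus)
      then have "\<exists>\<gamma>\<in>pos_roots. u ?a = emb \<gamma> - delta"
        using adm a inv_affine_weyl[of u w] u by (simp add: admissible_def)
      then have \<beta>: "\<beta> \<in> pos_roots" "k = -1" using b by (auto simp: emb_def delta_def)
      have "\<beta> \<in> \<Pi>"
      proof (rule ccontr)
        assume "\<beta> \<notin> \<Pi>"
        then obtain \<alpha> where \<alpha>: "\<alpha> \<in> \<Pi>" "\<beta> - \<alpha> \<in> pos_roots" using pos_root_decompose \<beta>(1) by blast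
        have "w (\<beta>, k, 0) = w ((\<alpha>, -1, 0) + (\<beta> - \<alpha>, 0, 0))" using \<beta>(2) by simp
        then have "center_value (w (\<beta>, k, 0))
            = center_value (w (\<alpha>, -1, 0)) + center_value (w (\<beta> - \<alpha>, 0, 0))"
          by (simp only: weyl_translations_linear[OF wt] center_value_linear)
        then show False
          using shifted[OF simple_pos_root[OF \<alpha>(1)]] shifted[OF \<alpha>(2)] center_w[of "\<beta> - \<alpha>" 0] cw h1 by simp
      qed
      then show ?thesis using ve b \<beta> by simp
    qed
  qed
  have simple_image: "v \<alpha> \<in> ext_simple \<and> ip (v r) (v \<alpha>) + 1 + level (v \<alpha>) = 0" if \<alpha>: "\<alpha> \<in> \<Pi>" for \<alpha>
  proof -
    have ar: "(\<alpha>, -1, 0) \<in> aroots" using simple_root[OF \<alpha>] by (simp add: aroots_def)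
    obtain k where k: "w (\<alpha>, -1, 0) = (v \<alpha>, k, 0)" by (simp add: w_apply)
    have va: "v \<alpha> \<in> \<Delta>" using weyl_root[OF v simple_root[OF \<alpha>]] .
    have "k \<in> \<int>" using weyl_translations_aroot[OF wt ar] k by (auto simp: aroots_def)
    then have kpos: "k \<ge> 1 \<or> (k = 0 \<and> v \<alpha> \<in> pos_roots)"
      using center_value_pos_iff[OF va] shifted[OF simple_pos_root[OF \<alpha>]] k by simp
    \<comment> \<open>Coefficients of \<open>w (\<alpha>, -1, 0)\<close> in the affine simple roots,
      found by expanding \<delta> with the marks; they are nonnegative because the root is
      positive.\<close>
    define n where "n e = k * mark e + (if e = - \<theta> then 0 else coord e (v \<alpha>))" for e
    have n_nonneg: "n e \<ge> 0" if e: "e \<in> ext_simple" for e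
    proof (cases "e = - \<theta>")
      case True
      then show ?thesis using kpos by (auto simp: n_def mark_def)
    next
      case False
      then have ep: "e \<in> \<Pi>" using e by (simp add: ext_simple_def)
      show ?thesis
        using kpos
      proof
        assume "k \<ge> 1"
        then have "k * mark e \<ge> 1 * mark e" using mark_ge_1[OF e] by (intro mult_right_mono) auto
        moreover have "- coord e (v \<alpha>) \<le> mark e"
          using coord_le_highest[OF root_minus[OF va] ep] False by (simp add: mark_def)
        ultimately show ?thesis using False by (simp add: n_def)
      next
        assume "k = 0 \<and> v \<alpha> \<in> pos_roots"
        then show ?thesis using ep False by (simp add: n_def pos_roots_iff)
      qed
    qed
    have "v \<alpha> = (\<Sum>e\<in>ext_simple. n e *s e)"
    proof (rule coord_eqI)
      fix \<gamma> assume "\<gamma> \<in> \<Pi>"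
      have "(\<Sum>e\<in>ext_simple. n e *s e)
          = k *s (- \<theta>) + (\<Sum>\<beta>\<in>\<Pi>. (k * coord \<beta> \<theta> + coord \<beta> (v \<alpha>)) *s \<beta>)"
        unfolding sum_ext_simple using minus_highest_not_simple
        by (auto simp: n_def mark_def intro!: sum.cong)
      then show "coord \<gamma> (v \<alpha>) = coord \<gamma> (\<Sum>e\<in>ext_simple. n e *s e)"
        using \<open>\<gamma> \<in> \<Pi>\<close> by (simp add: coord_lincomb)
    qed
    then have "v' (v \<alpha>) = (\<Sum>e\<in>ext_simple. n e *s v' e)"
      by (simp add: weyl_sum[OF v'(1)] weyl_linear[OF v'(1)])
    \<comment> \<open>Some preimage \<open>v' e\<close> must contribute positively to the coordinate
      1 at \<open>\<alpha>\<close>; by the dichotomy it is simple, hence \<open>\<alpha>\<close>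
      itself.\<close>
    then have "coord \<alpha> (v' (v \<alpha>)) = (\<Sum>e\<in>ext_simple. n e * coord \<alpha> (v' e))"
      by (simp only: coord_sum coord_scale)
    moreover have "coord \<alpha> (v' (v \<alpha>)) = 1" using \<alpha> by (simp add: v'(2) coord_simple)
    ultimately have "(\<Sum>e\<in>ext_simple. n e * coord \<alpha> (v' e)) > 0" by linarith
    then obtain e where e: "e \<in> ext_simple" "n e * coord \<alpha> (v' e) > 0"
      by (meson linorder_not_less sum_nonpos)
    then have cp: "coord \<alpha> (v' e) > 0" using n_nonneg[OF e(1)] by (simp add: zero_less_mult_iff)
    then have "- v' e \<notin> pos_roots" using \<alpha> by (auto simp: pos_roots_iff not_le intro!: bexI[of _ \<alpha>])
    then have s: "v' e \<in> \<Pi>" "u (e, level e, 0) = (v' e, -1, 0)" using simple_or_neg[OF e(1)] by auto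
    then have "v' e = \<alpha>" using cp by (simp add: coord_simple split: if_splits)
    then have e_eq: "e = v \<alpha>" using v'(3)[of e] by simp
    have "w (\<alpha>, -1, 0) = (e, level e, 0)" using s(2) u(3) \<open>v' e = \<alpha>\<close> by metis
    then have "level (v \<alpha>) = -1 - ip \<alpha> r" by (simp add: w_apply e_eq)
    then show ?thesis using e(1) e_eq weyl_ip[OF v, of r \<alpha>] by (simp add: ip_sym[of \<alpha> r])
  qed
  \<comment> \<open>As \<open>ext_simple\<close> has one element more than \<open>\<Pi>\<close>,
    exactly one facet normal is missed.\<close>
  have "card (v ` \<Pi>) = card \<Pi>" using v'(2) by (intro card_image inj_on_inverseI)
  moreover have "card ext_simple = card \<Pi> + 1"
    unfolding ext_simple_def using minus_highest_not_simple finite_Basis by simp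
  moreover have "v ` \<Pi> \<subseteq> ext_simple" using simple_image by blast
  ultimately have "card (ext_simple - v ` \<Pi>) = 1"
    using finite_Basis by (simp add: card_Diff_subset)
  then obtain g where g: "ext_simple - v ` \<Pi> = {g}" using card_1_singletonE by blast
  show ?thesis
  proof (rule vertex_if_facets)
    show "g \<in> ext_simple" using g by blast
    fix e assume "e \<in> ext_simple - {g}"
    then have "e \<in> v ` \<Pi>" using g by blast
    then show "ip (v r) e + 1 + level e = 0" using simple_image by blast
  qed
qed

text \<open>Every candidate in the definite description is an integral vertex, so uniqueness of that
  vertex makes the description well defined.\<close>

lemma d_point_pos_roots:
  "vertex (d_point pos_roots) simplex_D" "d_point pos_roots \<in> coroot_lattice"
proof -
  let ?Q = "\<lambda>d. \<exists>w v r. admissible w \<and> ideal_of w = pos_roots \<and>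
     v \<in> weyl \<and> r \<in> coroot_lattice \<and> w = lift v \<circ> translation r \<and> d = v r"
  have Q: "vertex d simplex_D \<and> d \<in> coroot_lattice" if "?Q d" for d
    using that admissible_pos_roots_vertex weyl_coroot_lattice by blast
  obtain w where w: "admissible w" "ideal_of w = pos_roots" using admissible_pos_roots_exists by blast
  then have "w \<in> weyl_translations" using affine_weyl_subset by (auto simp: admissible_def)
  then obtain v r where "w = lift v \<circ> translation r" "v \<in> weyl" "r \<in> coroot_lattice"
    by (auto simp: weyl_translations_def)
  then have "?Q (v r)" using w by blast
  moreover have "d = d'" if "?Q d" "?Q d'" for d d'
    using integral_vertex_unique Q[OF that(1)] Q[OF that(2)] by blast
  ultimately have "?Q (d_point pos_roots)"
    unfolding d_point_def by - (rule theI[where P = ?Q], blast+)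
  then show "vertex (d_point pos_roots) simplex_D" "d_point pos_roots \<in> coroot_lattice"
    using Q by blast+
qed

lemma maximal_ad_nilpotent_iff: "maximal_ad_nilpotent I \<longleftrightarrow> I = pos_roots"
proof -
  have "ad_nilpotent pos_roots" using pos_root_add by (auto simp: ad_nilpotent_def)
  moreover have "J \<subseteq> pos_roots" if "ad_nilpotent J" for J using that by (simp add: ad_nilpotent_def)
  ultimately show ?thesis unfolding maximal_ad_nilpotent_def by (metis subset_antisym)
qed

end

theorem corollary2p12:
  fixes scale :: "rat \<Rightarrow> 'v::ab_group_add \<Rightarrow> 'v"
    and \<Pi> \<Delta> :: "'v set"
    and ip :: "'v \<Rightarrow> 'v \<Rightarrow> rat"
    and \<theta> :: 'v
  assumes "simple_root_system scale \<Pi> ip \<Delta> \<theta>"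
  defines "D \<equiv> simple_root_system.simplex_D \<Pi> ip \<theta>"
    and "Qv \<equiv> simple_root_system.coroot_lattice scale \<Pi> ip"
    and "pos \<equiv> simple_root_system.pos_roots scale \<Pi> \<Delta>"
    and "d \<equiv> simple_root_system.d_point scale \<Pi> ip \<Delta> \<theta>"
  shows "(\<exists>!\<tau>. simple_root_system.vertex scale \<tau> D \<and> \<tau> \<in> Qv) \<and>
    (\<forall>I. simple_root_system.maximal_ad_nilpotent scale \<Pi> \<Delta> I \<longleftrightarrow> I = pos) \<and>
    simple_root_system.vertex scale (d pos) D \<and> d pos \<in> Qv"
proof -
  interpret simple_root_system scale \<Pi> ip \<Delta> \<theta> by (rule assms(1))
  show ?thesis
    unfolding D_def Qv_def pos_def d_def
    using d_point_pos_roots integral_vertex_unique maximal_ad_nilpotent_iff by blast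
qed

end
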